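(* Let $S$ be an arborescent poset with consistent anti-linearization $v:S\to[1,m]$ which is bijective, let $\lambda=(\lambda_1>\dots>\lambda_m\ge0)$ be regular, identify $\mathbb S_m\lambda\simeq\mathbb S_m$, and let $\mathbb D_S^v=\mathbb D_S^v(\lambda)\subset\mathbb S_m\lambda$ be the set of $S$-dominant compositions with the induced Bruhat order. Then: (1) the covering relations of $\mathbb D_S^v$ are given by transpositions associated with minimal disorders, i.e. $b$ covers $a$ iff $b=(ij)a$ for a minimal $S$-disorder $(ij)$ for $a$; (2) the poset $\mathbb D_S^v$ is bounded, graded, subthin and $\mathrm{EL}$-shellable; (3) the bubble-sort map $\mathrm{bs}_S:\mathbb S_m\to\mathbb D_S^v$ is a monotone nonincreasing idempotent (with image $\mathbb D_S^v$).
   Context: An arborescent poset with consistent anti-linearization is a finite poset $(S,\preceq)$ with an injective order-reversing map $v:S\to[1,m]$ ($s\succ t\Rightarrow v(s)<v(t)$) such that for every $s\in S$ the set $\{t:t\succeq s\}$ equals $v^{-1}([a_s,b_s])$ for some $a_s\le b_s$. A composition $d\in\mathbb Z_{\ge0}^m$ is $S$-dominant if $d_l=0$ for $l\notin v(S)$ and $d_{v(s)}\ge d_{v(t)}$ whenever $s\succ t$. The Bruhat order on $\mathbb S_m\lambda$ (rearrangements of $\lambda$) is the reflexive transitive closure of $a\prec(ij)a$ whenever $i<j$ and $a_i>a_j$, where $(ij)a$ exchanges the $i$-th and $j$-th entries. A pair $i<j$ is a minimal $S$-disorder for an $S$-dominant $d$ if: $v^{-1}(i)$, $v^{-1}(j)$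 are incomparable; $d_i>d_j$; and for all $i<l<j$: $v^{-1}(l)\prec v^{-1}(i)$ implies $d_l\le d_j$; $v^{-1}(l)\succ v^{-1}(j)$ implies $d_l\ge d_i$; $v^{-1}(l)$ incomparable with both implies $d_l\notin[d_j,d_i]$. Bubble sort: $d$ is $S[l]$-dominant if $d_{v(s)}\ge d_l$ for all $s\succ v^{-1}(l)$. For $d\in\mathbb S_m\lambda$ which is $S[l]$-dominant for all $l<k$, $\mathrm{bs}_S^k(d)$ is the output of: while $d$ is not $S[k]$-dominant, let $M$ be the set of $\preceq$-maximal elements of $\{s\in S:v(s)<k,\ d_{v(s)}<d_k\}$, let $j=\max v(M)$, and exchange $d_j$ and $d_k$. Then $\mathrm{bs}_S=\mathrm{bs}_S^m\circ\dots\circ\mathrm{bs}_S^1$. Poset terms. A self-map $F$ is nonincreasing if $F(x)\le x$, monotone if order-preserving, idempotent if $F\circ F=F$. Bounded: has a minimum and a maximum. Graded: all maximal chains between two comparable elements have the same length. Subthin: every open interval $(x,y)$ with $\mathrm{rk}(y)-\mathrm{rk}(x)=2$ has at most two elements. $\mathrm{EL}$-shellable: the edges of the Hasse diagram can be labelled by elements of a poset so that for any $x<y$ there is a unique maximal chain from $x$ to $y$ with strictly increasing labels (read from $x$ to $y$), and its label word is lexicographically minimal among maximal chains from $x$ to $y$. *)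

theory Defs
  imports "HOL-Combinatorics.Permutations" "HOL-Library.While_Combinator"
begin

section \<open>Poset terms\<close>

text \<open>
  A poset is a carrier set P with a relation r such that \<open>partial_order_on P r\<close>;
  \<open>(x, y) \<in> r\<close> stands for \<open>x \<le> y\<close>.
\<close>

definition covers :: "'a set \<Rightarrow> 'a rel \<Rightarrow> 'a \<Rightarrow> 'a \<Rightarrow> bool" where
  "covers P r x y \<longleftrightarrow> x \<in> P \<and> y \<in> P \<and> (x, y) \<in> r - Id \<and>
     \<not> (\<exists>z\<in>P. (x, z) \<in> r - Id \<and> (z, y) \<in> r - Id)"

definition is_minimum :: "'a set \<Rightarrow> 'a rel \<Rightarrow> 'a \<Rightarrow> bool" where
  "is_minimum P r x \<longleftrightarrow> x \<in> P \<and> (\<forall>y\<in>P. (x, y) \<in> r)"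

definition is_maximum :: "'a set \<Rightarrow> 'a rel \<Rightarrow> 'a \<Rightarrow> bool" where
  "is_maximum P r x \<longleftrightarrow> x \<in> P \<and> (\<forall>y\<in>P. (y, x) \<in> r)"

definition bounded_poset :: "'a set \<Rightarrow> 'a rel \<Rightarrow> bool" where
  "bounded_poset P r \<longleftrightarrow> (\<exists>x. is_minimum P r x) \<and> (\<exists>x. is_maximum P r x)"

text \<open>
  The maximal chains from x to y, written as the list of their elements from x to y.
  The length of a chain is the number of its edges, one less than the length of the list.
\<close>

definition maximal_chain :: "'a set \<Rightarrow> 'a rel \<Rightarrow> 'a \<Rightarrow> 'a \<Rightarrow> 'a list \<Rightarrow> bool" where
  "maximal_chain P r x y c \<longleftrightarrow>
     c \<noteq> [] \<and> set c \<subseteq> P \<and> hd c = x \<and> last c = y \<and> successively (covers P r) c"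

definition graded_poset :: "'a set \<Rightarrow> 'a rel \<Rightarrow> bool" where
  "graded_poset P r \<longleftrightarrow> (\<forall>x\<in>P. \<forall>y\<in>P. (x, y) \<in> r \<longrightarrow>
     (\<forall>c c'. maximal_chain P r x y c \<and> maximal_chain P r x y c' \<longrightarrow> length c = length c'))"

text \<open>
  The rank is the common length of the maximal chains from the minimum; it is meaningful for
  finite bounded graded posets only.
\<close>

definition rank :: "'a set \<Rightarrow> 'a rel \<Rightarrow> 'a \<Rightarrow> nat" where
  "rank P r x = (THE n. \<exists>b c. is_minimum P r b \<and> maximal_chain P r b x c \<and> length c = Suc n)"

definition open_interval :: "'a set \<Rightarrow> 'a rel \<Rightarrow> 'a \<Rightarrow> 'a \<Rightarrow> 'a set" where
  "open_interval P r x y = {z \<in> P. (x, z) \<in> r - Id \<and> (z, y) \<in> r - Id}"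

definition subthin :: "'a set \<Rightarrow> 'a rel \<Rightarrow> bool" where
  "subthin P r \<longleftrightarrow> (\<forall>x\<in>P. \<forall>y\<in>P. (x, y) \<in> r \<and> rank P r y = rank P r x + 2 \<longrightarrow>
     finite (open_interval P r x y) \<and> card (open_interval P r x y) \<le> 2)"

definition label_word :: "('a \<Rightarrow> 'a \<Rightarrow> 'l) \<Rightarrow> 'a list \<Rightarrow> 'l list" where
  "label_word lab c = map2 lab c (tl c)"

definition EL_labelling :: "'a set \<Rightarrow> 'a rel \<Rightarrow> 'l rel \<Rightarrow> ('a \<Rightarrow> 'a \<Rightarrow> 'l) \<Rightarrow> bool" where
  "EL_labelling P r R lab \<longleftrightarrow> (\<forall>x\<in>P. \<forall>y\<in>P. (x, y) \<in> r - Id \<longrightarrow>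
     (\<exists>c. maximal_chain P r x y c \<and>
          sorted_wrt (\<lambda>k l. (k, l) \<in> R - Id) (label_word lab c) \<and>
          (\<forall>c'. maximal_chain P r x y c' \<and>
                sorted_wrt (\<lambda>k l. (k, l) \<in> R - Id) (label_word lab c') \<longrightarrow> c' = c) \<and>
          (\<forall>c'. maximal_chain P r x y c' \<longrightarrow>
                (label_word lab c, label_word lab c') \<in> (lexord (R - Id))\<^sup>=)))"

text \<open>
  The label poset ranges over all partial orders on the type of natural numbers. For a finite poset
  only finitely many labels occur, so every label poset can be transported to such an order.
\<close>

definition EL_shellable :: "'a set \<Rightarrow> 'a rel \<Rightarrow> bool" where
  "EL_shellable P r \<longleftrightarrow>
     (\<exists>(R :: nat rel) lab. partial_order_on UNIV R \<and> EL_labelling P r R lab)"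


section \<open>Rearrangements and the Bruhat order\<close>

text \<open>
  A composition in \<open>\<int>\<^sub>\<ge>\<^sub>0\<^sup>m\<close> is a function on the natural numbers that vanishes outside \<open>{1..m}\<close>.
  The composition \<open>(i j) d\<close>, with entries i and j of d exchanged, is \<open>d \<circ> transpose i j\<close>.
\<close>

definition rearrangements :: "nat \<Rightarrow> (nat \<Rightarrow> nat) \<Rightarrow> (nat \<Rightarrow> nat) set" where
  "rearrangements m lam = {lam \<circ> p | p. p permutes {1..m}}"

definition bruhat_steps :: "nat \<Rightarrow> (nat \<Rightarrow> nat) rel" where
  "bruhat_steps m = {(a, a \<circ> transpose i j) | a i j.
     i \<in> {1..m} \<and> j \<in> {1..m} \<and> i < j \<and> a i > a j}"

definition bruhat :: "nat \<Rightarrow> (nat \<Rightarrow> nat) \<Rightarrow> (nat \<Rightarrow> nat) rel" where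
  "bruhat m lam = Restr ((bruhat_steps m)\<^sup>*) (rearrangements m lam)"


section \<open>Arborescent posets and dominant compositions\<close>

text \<open>
  In the following r is the order relation of S, with \<open>(s, t) \<in> r\<close> for \<open>s \<preceq> t\<close>, and v is the
  anti-linearization.
\<close>

definition arborescent_poset :: "nat \<Rightarrow> 's set \<Rightarrow> 's rel \<Rightarrow> ('s \<Rightarrow> nat) \<Rightarrow> bool" where
  "arborescent_poset m S r v \<longleftrightarrow>
     finite S \<and> partial_order_on S r \<and>
     v ` S \<subseteq> {1..m} \<and> inj_on v S \<and>
     (\<forall>s\<in>S. \<forall>t\<in>S. (t, s) \<in> r - Id \<longrightarrow> v s < v t) \<and>
     (\<forall>s\<in>S. \<exists>a b. a \<le> b \<and> {t \<in> S. (s, t) \<in> r} = {t \<in> S. v t \<in> {a..b}})"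

definition incomparable :: "'s rel \<Rightarrow> 's \<Rightarrow> 's \<Rightarrow> bool" where
  "incomparable r s t \<longleftrightarrow> (s, t) \<notin> r \<and> (t, s) \<notin> r"

definition S_dominant ::
    "nat \<Rightarrow> 's set \<Rightarrow> 's rel \<Rightarrow> ('s \<Rightarrow> nat) \<Rightarrow> (nat \<Rightarrow> nat) \<Rightarrow> bool" where
  "S_dominant m S r v d \<longleftrightarrow>
     (\<forall>l\<in>{1..m}. l \<notin> v ` S \<longrightarrow> d l = 0) \<and>
     (\<forall>s\<in>S. \<forall>t\<in>S. (t, s) \<in> r - Id \<longrightarrow> d (v s) \<ge> d (v t))"

definition dominant_set ::
    "nat \<Rightarrow> 's set \<Rightarrow> 's rel \<Rightarrow> ('s \<Rightarrow> nat) \<Rightarrow> (nat \<Rightarrow> nat) \<Rightarrow> (nat \<Rightarrow> nat) set" where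
  "dominant_set m S r v lam = {d \<in> rearrangements m lam. S_dominant m S r v d}"

definition dominant_order ::
    "nat \<Rightarrow> 's set \<Rightarrow> 's rel \<Rightarrow> ('s \<Rightarrow> nat) \<Rightarrow> (nat \<Rightarrow> nat) \<Rightarrow> (nat \<Rightarrow> nat) rel" where
  "dominant_order m S r v lam = Restr (bruhat m lam) (dominant_set m S r v lam)"

definition minimal_disorder ::
    "nat \<Rightarrow> 's set \<Rightarrow> 's rel \<Rightarrow> ('s \<Rightarrow> nat) \<Rightarrow> (nat \<Rightarrow> nat) \<Rightarrow> nat \<Rightarrow> nat \<Rightarrow> bool" where
  "minimal_disorder m S r v d i j \<longleftrightarrow> S_dominant m S r v d \<and> i < j \<and>
     (\<exists>s\<in>S. \<exists>t\<in>S. v s = i \<and> v t = j \<and> incomparable r s t \<and> d i > d j \<and>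
        (\<forall>u\<in>S. i < v u \<and> v u < j \<longrightarrow>
           ((u, s) \<in> r - Id \<longrightarrow> d (v u) \<le> d j) \<and>
           ((t, u) \<in> r - Id \<longrightarrow> d (v u) \<ge> d i) \<and>
           (incomparable r u s \<and> incomparable r u t \<longrightarrow> d (v u) \<notin> {d j..d i})))"


section \<open>Bubble sort\<close>

definition dominant_at ::
    "'s set \<Rightarrow> 's rel \<Rightarrow> ('s \<Rightarrow> nat) \<Rightarrow> nat \<Rightarrow> (nat \<Rightarrow> nat) \<Rightarrow> bool" where
  "dominant_at S r v l d \<longleftrightarrow>
     (\<forall>s\<in>S. \<forall>t\<in>S. v t = l \<and> (t, s) \<in> r - Id \<longrightarrow> d (v s) \<ge> d l)"

definition maximal_elements :: "'s rel \<Rightarrow> 's set \<Rightarrow> 's set" where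
  "maximal_elements r X = {s \<in> X. \<not> (\<exists>t\<in>X. (s, t) \<in> r - Id)}"

definition bs_step ::
    "'s set \<Rightarrow> 's rel \<Rightarrow> ('s \<Rightarrow> nat) \<Rightarrow> nat \<Rightarrow> (nat \<Rightarrow> nat) \<Rightarrow> (nat \<Rightarrow> nat)" where
  "bs_step S r v k d =
     (let M = maximal_elements r {s \<in> S. v s < k \<and> d (v s) < d k}
      in d \<circ> transpose (Max (v ` M)) k)"

definition bs_at ::
    "'s set \<Rightarrow> 's rel \<Rightarrow> ('s \<Rightarrow> nat) \<Rightarrow> nat \<Rightarrow> (nat \<Rightarrow> nat) \<Rightarrow> (nat \<Rightarrow> nat)" where
  "bs_at S r v k = while (\<lambda>d. \<not> dominant_at S r v k d) (bs_step S r v k)"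

text \<open>
  \<open>fold\<close> applies \<open>bs_at\<close> at 1 first and at m last.
\<close>

definition bs ::
    "nat \<Rightarrow> 's set \<Rightarrow> 's rel \<Rightarrow> ('s \<Rightarrow> nat) \<Rightarrow> (nat \<Rightarrow> nat) \<Rightarrow> (nat \<Rightarrow> nat)" where
  "bs m S r v = fold (bs_at S r v) [1..<Suc m]"


section \<open>The induced Bruhat order is a partial order\<close>

lemma bruhat_steps_weight:
  assumes "(a, b) \<in> bruhat_steps m"
  shows "(\<Sum>l\<in>{1..m}. l * a l) < (\<Sum>l\<in>{1..m}. l * b l)"
proof -
  from assms obtain i j where ij: "i \<in> {1..m}" "j \<in> {1..m}" "i < j" "a i > a j"
    and b: "b = a \<circ> transpose i j"
    unfolding bruhat_steps_def by blast
  let ?R = "{1..m} - {i} - {j}"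
  have split: "(\<Sum>l\<in>{1..m}. l * f l) = i * f i + (j * f j + (\<Sum>l\<in>?R. l * f l))"
    for f :: "nat \<Rightarrow> nat"
  proof -
    have "(\<Sum>l\<in>{1..m}. l * f l) = i * f i + (\<Sum>l\<in>{1..m} - {i}. l * f l)"
      by (rule sum.remove) (use ij in simp_all)
    also have "(\<Sum>l\<in>{1..m} - {i}. l * f l) = j * f j + (\<Sum>l\<in>?R. l * f l)"
      by (rule sum.remove) (use ij in simp_all)
    finally show ?thesis .
  qed
  have rest: "(\<Sum>l\<in>?R. l * b l) = (\<Sum>l\<in>?R. l * a l)"
    by (rule sum.cong) (auto simp: b transpose_def)
  obtain p q where p: "j = i + p" "0 < p" and q: "a i = a j + q" "0 < q"
    using ij(3,4) less_imp_add_positive by metis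
  have "i * a i + j * a j < i * a j + j * a i"
    using p q by (simp add: algebra_simps)
  then show ?thesis
    unfolding split rest by (simp add: b)
qed

lemma antisym_bruhat_steps: "antisym ((bruhat_steps m)\<^sup>*)"
proof -
  have "(a, b) \<in> (bruhat_steps m)\<^sup>+ \<Longrightarrow> (\<Sum>l\<in>{1..m}. l * a l) < (\<Sum>l\<in>{1..m}. l * b l)" for a b
    by (induction rule: trancl_induct) (auto dest: bruhat_steps_weight)
  then have "acyclic (bruhat_steps m)"
    unfolding acyclic_def by blast
  then show ?thesis
    by (rule acyclic_impl_antisym_rtrancl)
qed

lemma partial_order_on_Restr_rtrancl:
  assumes "antisym (R\<^sup>*)"
  shows "partial_order_on A (Restr (R\<^sup>*) A)"
proof -
  have "refl_on A (Restr (R\<^sup>*) A)"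
    by (simp add: refl_on_def)
  moreover have "trans (Restr (R\<^sup>*) A)"
    by (rule trans_Restr) (rule trans_rtrancl)
  moreover have "antisym (Restr (R\<^sup>*) A)"
    using assms by (rule antisym_Restr)
  ultimately show ?thesis
    unfolding partial_order_on_def preorder_on_def by blast
qed

lemma partial_order_on_bruhat: "partial_order_on (rearrangements m lam) (bruhat m lam)"
  unfolding bruhat_def
  by (rule partial_order_on_Restr_rtrancl) (rule antisym_bruhat_steps)

lemma partial_order_on_dominant_order:
  "partial_order_on (dominant_set m S r v lam) (dominant_order m S r v lam)"
proof -
  have "dominant_set m S r v lam \<subseteq> rearrangements m lam"
    unfolding dominant_set_def by (rule Collect_restrict)
  then have "dominant_order m S r v lam = Restr ((bruhat_steps m)\<^sup>*) (dominant_set m S r v lam)"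
    unfolding dominant_order_def bruhat_def by blast
  then show ?thesis
    by (simp only: partial_order_on_Restr_rtrancl[OF antisym_bruhat_steps])
qed

end

theory Submission
  imports Defs
begin

text \<open>
  Since v is bijective, S may be read on the positions 1, ..., m: the elements above position k form
  an interval \<open>{A k..k}\<close>, and these intervals are laminar, so S is a forest in postorder and d is
  dominant iff \<open>d k\<close> is the minimum of d on \<open>{A k..k}\<close> for every k.
  Bruhat order is compared with the counting criterion \<open>prefix_le\<close>.

  Everything rests on one greedy step. Given dominant \<open>x \<noteq> y\<close> with \<open>prefix_le x y\<close>, let i be the
  first position in preorder (parents before children, left to right) where x and y differ; then
  \<open>y i < x i\<close>. Let \<open>j > i\<close> be the nearest position incomparable with i with \<open>y i \<le> x j < x i\<close>.
  Exchanging i and j gives a Bruhat cover of x that is again dominant and still below y.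
  Hence the covers among dominant elements are exactly the Bruhat covers between dominant elements,
  the number of inversions is a rank function, and labelling the exchange of i and j
  lexicographically, by i in preorder and then by j, is an EL-labelling whose increasing chains are
  the greedy ones. For an antichain S the same step proves the counting criterion itself.

  Bubble sort maps d to the greatest dominant element below d, because each of its exchanges stays
  above all dominant elements below d. Monotonicity and idempotence follow.
\<close>

subsection \<open>The counting criterion and inversions\<close>

definition prefix_count :: "(nat \<Rightarrow> nat) \<Rightarrow> nat \<Rightarrow> nat \<Rightarrow> nat" where
  "prefix_count d p q = (\<Sum>l\<in>{1..p}. of_bool (q \<le> d l))"

text \<open>Ehresmann's tableau criterion for Bruhat order. The counts compare in reverse because
  the least element is the decreasing one.\<close>

definition prefix_le :: "(nat \<Rightarrow> nat) \<Rightarrow> (nat \<Rightarrow> nat) \<Rightarrow> bool" where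
  "prefix_le x y \<longleftrightarrow> (\<forall>p q. prefix_count y p q \<le> prefix_count x p q)"

definition cover_step :: "nat \<Rightarrow> (nat \<Rightarrow> nat) \<Rightarrow> nat \<Rightarrow> nat \<Rightarrow> bool" where
  "cover_step m d i j \<longleftrightarrow> i \<in> {1..m} \<and> j \<in> {1..m} \<and> i < j \<and> d j < d i \<and>
     (\<forall>l\<in>{i<..<j}. d l \<notin> {d j..d i})"

text \<open>The length is measured from the decreasing word, so ascending pairs are counted and the
  number grows along the order.\<close>

definition inversions :: "nat \<Rightarrow> (nat \<Rightarrow> nat) \<Rightarrow> nat" where
  "inversions m d = (\<Sum>p\<in>{1..m}. \<Sum>q\<in>{1..m}. of_bool (p < q \<and> d p < d q))"

lemma prefix_count_0 [simp]: "prefix_count d 0 q = 0"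
  by (simp add: prefix_count_def)

lemma prefix_count_Suc [simp]:
  "prefix_count d (Suc p) q = prefix_count d p q + of_bool (q \<le> d (Suc p))"
  by (simp add: prefix_count_def)

lemma prefix_le_refl [simp]: "prefix_le x x"
  by (simp add: prefix_le_def)

lemma prefix_le_trans: "prefix_le x y \<Longrightarrow> prefix_le y z \<Longrightarrow> prefix_le x z"
  unfolding prefix_le_def by (meson le_trans)

text \<open>The exchange replaces a large entry by a small one in the prefixes with
  \<open>i \<le> p < j\<close>, which only thresholds \<open>d j < q \<le> d i\<close> notice.
  Adding the loss on the left avoids subtraction.\<close>

lemma prefix_count_transpose:
  assumes "1 \<le> i" "i < j" "d j < d i"
  shows "prefix_count (d \<circ> transpose i j) p q +
           of_bool (i \<le> p \<and> p < j \<and> d j < q \<and> q \<le> d i) = prefix_count d p q"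
proof (induction p)
  case 0
  then show ?case using assms by simp
next
  case (Suc p)
  consider "Suc p < i" | "Suc p = i" | "i < Suc p" "Suc p < j" | "Suc p = j" | "j < Suc p"
    by linarith
  then show ?case
    using Suc assms by cases (auto simp: transpose_def split: if_splits)
qed

lemma prefix_le_transpose:
  assumes "1 \<le> i" "i < j" "d j < d i"
  shows "prefix_le d (d \<circ> transpose i j)"
  unfolding prefix_le_def using prefix_count_transpose[of i j d, OF assms]
  by (metis le_add1)

lemma bruhat_steps_imp_prefix_le: "(x, y) \<in> (bruhat_steps m)\<^sup>* \<Longrightarrow> prefix_le x y"
proof (induction rule: rtrancl_induct)
  case (step y z)
  then show ?case
    unfolding bruhat_steps_def by (auto intro!: prefix_le_trans[of x y] prefix_le_transpose)
qed simp

lemma prefix_count_add: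
  assumes "p \<le> p'"
  shows "prefix_count d p' q = prefix_count d p q + (\<Sum>l\<in>{Suc p..p'}. of_bool (q \<le> d l))"
  using assms by (induction rule: dec_induct) auto

lemma prefix_count_le:
  assumes "p \<le> p'"
  shows "prefix_count d p' q \<le> prefix_count d p q + (p' - p)"
  using assms by (induction rule: dec_induct) auto

lemma prefix_count_full:
  assumes "p \<le> p'" "\<And>l. p < l \<Longrightarrow> l \<le> p' \<Longrightarrow> q \<le> d l"
  shows "prefix_count d p' q = prefix_count d p q + (p' - p)"
  using assms by (induction rule: dec_induct) auto

lemma prefix_count_not_full:
  assumes "p < j" "j \<le> p'" "d j < q"
  shows "prefix_count d p' q < prefix_count d p q + (p' - p)"
  using assms(2)
proof (induction rule: dec_induct)
  case base
  have "prefix_count d (j - 1) q \<le> prefix_count d p q + (j - 1 - p)"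
    using assms by (intro prefix_count_le) simp
  moreover have "prefix_count d j q = prefix_count d (j - 1) q"
    using assms prefix_count_Suc[of d "j - 1" q] by simp
  ultimately show ?case using assms by linarith
next
  case (step n)
  then show ?case using assms by auto
qed

lemma prefix_count_split:
  assumes "u \<le> q"
  shows "prefix_count d p u = prefix_count d p q + (\<Sum>l\<in>{1..p}. of_bool (u \<le> d l \<and> d l < q))"
  using assms by (induction p) auto

lemma sum_sum_remove2:
  fixes F :: "nat \<Rightarrow> nat \<Rightarrow> nat"
  assumes "finite U" "i \<in> U" "j \<in> U" "i \<noteq> j"
  shows "(\<Sum>p\<in>U. \<Sum>q\<in>U. F p q) = F i i + F i j + F j i + F j j +
     (\<Sum>l\<in>U - {i} - {j}. F i l + F l i + F j l + F l j) +
     (\<Sum>p\<in>U - {i} - {j}. \<Sum>q\<in>U - {i} - {j}. F p q)"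
proof -
  have *: "sum f U = f i + (f j + sum f (U - {i} - {j}))" for f :: "nat \<Rightarrow> nat"
    using assms by (simp add: sum.remove[of U i] sum.remove[of "U - {i}" j])
  show ?thesis
    unfolding * by (simp add: sum.distrib algebra_simps)
qed

text \<open>The pair \<open>(i, j)\<close> itself is the new inversion. A position outside the
  interval merely swaps its pairs with \<open>i\<close> and \<open>j\<close>; inside,
  \<open>d l\<close> is above or below both exchanged entries, so its pairs keep their
  total.\<close>

lemma inversions_cover_step:
  assumes "cover_step m d i j"
  shows "inversions m (d \<circ> transpose i j) = Suc (inversions m d)"
proof -
  let ?U = "{1..m}" and ?e = "d \<circ> transpose i j"
  let ?R = "?U - {i} - {j}"
  let ?F = "\<lambda>d p q. of_bool (p < q \<and> d p < d q) :: nat"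
  have ij: "i \<in> ?U" "j \<in> ?U" "i < j" "d j < d i"
    and btw: "\<And>l. i < l \<Longrightarrow> l < j \<Longrightarrow> d l \<notin> {d j..d i}"
    using assms by (auto simp: cover_step_def)
  have e: "?e i = d j" "?e j = d i" "\<And>l. l \<in> ?R \<Longrightarrow> ?e l = d l"
    using ij by (auto simp: transpose_def)
  note split = sum_sum_remove2[OF finite_atLeastAtMost ij(1,2) less_imp_neq[OF ij(3)]]
  have A: "(\<Sum>p\<in>?R. \<Sum>q\<in>?R. ?F ?e p q) = (\<Sum>p\<in>?R. \<Sum>q\<in>?R. ?F d p q)"
    by (intro sum.cong refl) (simp add: e del: o_apply)
  have B: "?F ?e i l + ?F ?e l i + ?F ?e j l + ?F ?e l j = ?F d i l + ?F d l i + ?F d j l + ?F d l j"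
    if l: "l \<in> ?R" for l
  proof -
    consider "l < i" | "i < l" "l < j" | "j < l" using l by force
    then show ?thesis
    proof cases
      case 2
      then show ?thesis using l ij btw[of l] by (auto simp: e simp del: o_apply)
    qed (use l ij in \<open>auto simp: e simp del: o_apply\<close>)
  qed
  have "(\<Sum>l\<in>?R. ?F ?e i l + ?F ?e l i + ?F ?e j l + ?F ?e l j) =
      (\<Sum>l\<in>?R. ?F d i l + ?F d l i + ?F d j l + ?F d l j)"
    by (rule sum.cong[OF refl B])
  then show ?thesis
    unfolding inversions_def split A using ij by (simp only: e) simp
qed

lemma inversions_le: "inversions m d \<le> m * m"
proof -
  have "inversions m d \<le> (\<Sum>p\<in>{1..m}. \<Sum>q\<in>{1..m}. 1)"
    unfolding inversions_def by (intro sum_mono) simp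
  then show ?thesis by simp
qed

lemma cover_step_bruhat_steps:
  "cover_step m d i j \<Longrightarrow> (d, d \<circ> transpose i j) \<in> bruhat_steps m"
  unfolding cover_step_def bruhat_steps_def by blast

subsection \<open>Forests in postorder and the greedy step\<close>

locale regular_weight =
  fixes m :: nat and lam :: "nat \<Rightarrow> nat"
  assumes antimono: "strict_antimono_on {1..m} lam"
begin

abbreviation "W \<equiv> rearrangements m lam"

lemma lam_less: "i \<in> {1..m} \<Longrightarrow> j \<in> {1..m} \<Longrightarrow> i < j \<Longrightarrow> lam j < lam i"
  using antimono by (auto simp: monotone_on_def)

lemma inj_lam: "inj_on lam {1..m}"
  by (rule linorder_inj_onI) (use lam_less in fastforce)+

lemma inj_W: "d \<in> W \<Longrightarrow> inj_on d {1..m}"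
  unfolding rearrangements_def
  using inj_lam by (auto intro!: comp_inj_on simp: permutes_image intro: permutes_inj_on simp del: One_nat_def)

lemma eq_W_iff: "d \<in> W \<Longrightarrow> i \<in> {1..m} \<Longrightarrow> j \<in> {1..m} \<Longrightarrow> d i = d j \<longleftrightarrow> i = j"
  using inj_W by (meson inj_onD)

lemma image_W: "d \<in> W \<Longrightarrow> d ` {1..m} = lam ` {1..m}"
  unfolding rearrangements_def by (clarify, metis image_comp permutes_image)

lemma outside_W: "d \<in> W \<Longrightarrow> l \<notin> {1..m} \<Longrightarrow> d l = lam l"
  unfolding rearrangements_def by (auto simp: permutes_def)

lemma ext_W:
  assumes "x \<in> W" "y \<in> W" "\<And>l. l \<in> {1..m} \<Longrightarrow> x l = y l"
  shows "x = y"
  using assms outside_W by (metis ext)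

lemma transpose_W:
  assumes "d \<in> W" "i \<in> {1..m}" "j \<in> {1..m}"
  shows "d \<circ> transpose i j \<in> W"
proof -
  from assms(1) obtain p where "d = lam \<circ> p" "p permutes {1..m}"
    unfolding rearrangements_def by blast
  then have "d \<circ> transpose i j = lam \<circ> (p \<circ> transpose i j)" "p \<circ> transpose i j permutes {1..m}"
    using permutes_compose[OF permutes_swap_id[OF assms(2,3)]] by (simp_all only: comp_assoc)
  then show ?thesis
    unfolding rearrangements_def by blast
qed

lemma lam_W: "lam \<in> W"
  unfolding rearrangements_def using permutes_id by (metis (mono_tags) CollectI comp_id)

lemma cover_step_W: "d \<in> W \<Longrightarrow> cover_step m d i j \<Longrightarrow> d \<circ> transpose i j \<in> W"
  by (simp add: cover_step_def transpose_W)

text \<open>Since \<open>lam\<close> decreases, for \<open>p \<le> m\<close> either its first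
  \<open>p\<close> entries all reach \<open>q\<close> and the count is \<open>p\<close>, or no later
  position up to \<open>m\<close> reaches \<open>q\<close> and the count is the total, which all
  rearrangements share.\<close>

lemma lam_prefix_le:
  assumes y: "y \<in> W"
  shows "prefix_le lam y"
  unfolding prefix_le_def
proof (intro allI)
  fix p q
  have tot: "prefix_count y m q = prefix_count lam m q"
  proof -
    have *: "prefix_count d m q = card {u \<in> lam ` {1..m}. q \<le> u}" if "d \<in> W" for d
    proof -
      have "prefix_count d m q = card {l \<in> {1..m}. q \<le> d l}"
        by (simp add: prefix_count_def Int_def conj_commute)
      also have "\<dots> = card (d ` {l \<in> {1..m}. q \<le> d l})"
        using inj_W[OF that] by (intro card_image[symmetric]) (auto intro: inj_on_subset)
      also have "d ` {l \<in> {1..m}. q \<le> d l} = {u \<in> lam ` {1..m}. q \<le> u}"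
        unfolding image_W[OF that, symmetric] by blast
      finally show ?thesis .
    qed
    show ?thesis using *[OF y] *[OF lam_W] by simp
  qed
  have le: "prefix_count y p q \<le> prefix_count lam p q" if "p \<le> m" for p
  proof (cases "\<forall>l. 0 < l \<longrightarrow> l \<le> p \<longrightarrow> q \<le> lam l")
    case True
    then show ?thesis
      using prefix_count_full[of 0 p q lam] prefix_count_le[of 0 p y q] by simp
  next
    case False
    then obtain l where l: "0 < l" "l \<le> p" "lam l < q" by (meson not_le)
    have "lam t < q" if "p < t" "t \<le> m" for t
    proof -
      have "lam t < lam l" using that l \<open>p \<le> m\<close> by (intro lam_less) auto
      then show ?thesis using l by simp
    qed
    then have "\<not> q \<le> lam t" if "t \<in> {Suc p..m}" for t
      using that by (simp add: not_le)
    then have "prefix_count lam m q = prefix_count lam p q"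
      unfolding prefix_count_add[OF \<open>p \<le> m\<close>, of lam q] by simp
    then show ?thesis
      using tot prefix_count_add[OF \<open>p \<le> m\<close>, of y q] by simp
  qed
  show "prefix_count y p q \<le> prefix_count lam p q"
  proof (cases "p \<le> m")
    case False
    have "prefix_count y p q = prefix_count lam p q"
      using False tot outside_W[OF y]
      by (simp add: prefix_count_add[of m p])
    then show ?thesis by simp
  qed (rule le)
qed

end

section \<open>Forests of positions and their dominant compositions\<close>

locale forest = regular_weight +
  fixes A :: "nat \<Rightarrow> nat"
  assumes A_bounds: "k \<in> {1..m} \<Longrightarrow> 1 \<le> A k \<and> A k \<le> k"
    and A_laminar: "k \<in> {1..m} \<Longrightarrow> j \<in> {A k..k} \<Longrightarrow> A k \<le> A j"
begin

definition dominant :: "(nat \<Rightarrow> nat) \<Rightarrow> bool" where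
  "dominant d \<longleftrightarrow> (\<forall>k\<in>{1..m}. \<forall>j\<in>{A k..k}. d k \<le> d j)"

definition D :: "(nat \<Rightarrow> nat) set" where
  "D = {d \<in> W. dominant d}"

text \<open>
  Preorder: ancestors have the larger positions, hence the reversed comparison in case of a tie.
\<close>

definition before :: "nat \<Rightarrow> nat \<Rightarrow> bool" where
  "before i l \<longleftrightarrow> A i < A l \<or> A i = A l \<and> l < i"

text \<open>The triple \<open>(A i, m - i, j)\<close> as digits to base \<open>Suc m\<close>: the
  lexicographic order of exchanges, encoded in the natural numbers that \<open>EL_shellable\<close>
  uses as labels.\<close>

definition pair_label :: "nat \<Rightarrow> nat \<Rightarrow> nat" where
  "pair_label i j = (A i * Suc m + (m - i)) * Suc m + j"

text \<open>The chain \<open>y i \<le> x j < x i\<close> makes \<open>i\<close> a position of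
  difference, hence the first one in preorder; the last clause makes \<open>j\<close> the nearest
  admissible partner.\<close>

definition greedy :: "(nat \<Rightarrow> nat) \<Rightarrow> (nat \<Rightarrow> nat) \<Rightarrow> nat \<Rightarrow> nat \<Rightarrow> bool" where
  "greedy x y i j \<longleftrightarrow> i \<in> {1..m} \<and> j \<in> {1..m} \<and> i < A j \<and> y i \<le> x j \<and> x j < x i \<and>
     (\<forall>l\<in>{1..m}. before l i \<longrightarrow> x l = y l) \<and>
     (\<forall>l\<in>{i<..<j}. i < A l \<longrightarrow> \<not> (y i \<le> x l \<and> x l < x i))"

text \<open>
  For positions \<open>i < j\<close>, incomparability in S reads \<open>i < A j\<close>; this is the condition of a minimal disorder.
\<close>

definition exchangeable :: "(nat \<Rightarrow> nat) \<Rightarrow> nat \<Rightarrow> nat \<Rightarrow> bool" where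
  "exchangeable d i j \<longleftrightarrow> i \<in> {1..m} \<and> j \<in> {1..m} \<and> i < A j \<and> d j < d i \<and>
     (\<forall>l\<in>{i<..<j}. (A l \<le> i \<longrightarrow> d l \<le> d j) \<and> (A j \<le> l \<longrightarrow> d i \<le> d l) \<and>
        (i < A l \<and> l < A j \<longrightarrow> d l \<notin> {d j..d i}))"

lemma greedyD:
  assumes "greedy x y i j"
  shows "i \<in> {1..m}" "j \<in> {1..m}" "i < A j" "i < j" "y i \<le> x j" "x j < x i"
    and "\<And>l. l \<in> {1..m} \<Longrightarrow> before l i \<Longrightarrow> x l = y l"
    and "\<And>l. i < l \<Longrightarrow> l < j \<Longrightarrow> i < A l \<Longrightarrow> x l < y i \<or> x i \<le> x l"
proof -
  show j: "i < A j" "j \<in> {1..m}" using assms unfolding greedy_def by blast+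
  show "i < j" using j(1) A_bounds[OF j(2)] by linarith
  show "x l < y i \<or> x i \<le> x l" if "i < l" "l < j" "i < A l" for l
  proof -
    have "\<not> (y i \<le> x l \<and> x l < x i)"
      using assms that unfolding greedy_def by (metis greaterThanLessThan_iff)
    then show ?thesis by linarith
  qed
qed (use assms in \<open>unfold greedy_def, blast\<close>)+

lemma D_W: "d \<in> D \<Longrightarrow> d \<in> W"
  by (simp add: D_def)

lemma D_dominant: "d \<in> D \<Longrightarrow> k \<in> {1..m} \<Longrightarrow> A k \<le> j \<Longrightarrow> j \<le> k \<Longrightarrow> d k \<le> d j"
  by (simp add: D_def dominant_def)

lemma D_dominant_less: "d \<in> D \<Longrightarrow> k \<in> {1..m} \<Longrightarrow> A k \<le> j \<Longrightarrow> j < k \<Longrightarrow> d k < d j"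
  using D_dominant[of d k j] eq_W_iff[OF D_W, of d k j] A_bounds[of k] by fastforce

lemma lam_D: "lam \<in> D"
proof -
  have "lam k \<le> lam j" if "k \<in> {1..m}" "j \<in> {A k..k}" for k j
  proof (cases "j = k")
    case False
    then show ?thesis
      using that A_bounds[OF that(1)] by (intro less_imp_le lam_less) auto
  qed simp
  then show ?thesis
    using lam_W by (simp add: D_def dominant_def)
qed

lemma before_total: "before i l \<or> i = l \<or> before l i"
  by (auto simp: before_def)

lemma before_trans: "before i l \<Longrightarrow> before l k \<Longrightarrow> before i k"
  by (auto simp: before_def)

lemma before_irrefl: "\<not> before i i"
  by (auto simp: before_def)

lemma before_right: "i \<in> {1..m} \<Longrightarrow> i < A j \<Longrightarrow> before i j"
  using A_bounds[of i] by (auto simp: before_def)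

lemma lex_nat_less:
  fixes x y x' y' M :: nat
  assumes "y < M" "y' < M"
  shows "x * M + y < x' * M + y' \<longleftrightarrow> x < x' \<or> x = x' \<and> y < y'"
proof -
  have "a * M + b < a' * M + b'" if "a < a'" "b < M" for a b a' b'
  proof -
    have "Suc a * M \<le> a' * M" using that by (intro mult_right_mono) auto
    then show ?thesis using that by simp
  qed
  then show ?thesis using assms by (metis add_less_cancel_left not_less_iff_gr_or_eq)
qed

lemma pair_label_less:
  assumes "i \<in> {1..m}" "j \<in> {1..m}" "i' \<in> {1..m}" "j' \<in> {1..m}"
  shows "pair_label i j < pair_label i' j' \<longleftrightarrow> before i i' \<or> i = i' \<and> j < j'"
proof -
  have "A i * Suc m + (m - i) < A i' * Suc m + (m - i') \<longleftrightarrow> before i i'"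
    using assms by (subst lex_nat_less) (auto simp: before_def)
  moreover have "A i * Suc m + (m - i) = A i' * Suc m + (m - i') \<longleftrightarrow> i = i'"
  proof
    assume "A i * Suc m + (m - i) = A i' * Suc m + (m - i')"
    then have "A i * Suc m + (m - i) \<le> A i' * Suc m + (m - i')"
      "A i' * Suc m + (m - i') \<le> A i * Suc m + (m - i)" by simp_all
    then have "m - i = m - i'"
      using lex_nat_less[of "m - i" "Suc m" "m - i'" "A i" "A i'"]
        lex_nat_less[of "m - i'" "Suc m" "m - i" "A i'" "A i"] by linarith
    then show "i = i'" using assms by auto
  qed simp
  ultimately show ?thesis
    unfolding pair_label_def using assms by (subst lex_nat_less) auto
qed

text \<open>If \<open>j\<close> were below \<open>i\<close>, the larger entry moved to
  \<open>j\<close> would exceed the entry now at \<open>i\<close>, against dominance.\<close>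

lemma cover_step_D_incomparable:
  assumes "x \<in> D" "x \<circ> transpose i j \<in> D" "cover_step m x i j"
  shows "i < A j"
proof (rule ccontr)
  assume "\<not> i < A j"
  then have "(x \<circ> transpose i j) j \<le> (x \<circ> transpose i j) i"
    using D_dominant[OF assms(2), of j i] assms(3) by (simp add: cover_step_def del: o_apply)
  then show False using assms by (simp add: cover_step_def)
qed

text \<open>A position between \<open>i\<close> and \<open>j\<close> is below \<open>i\<close>,
  above \<open>j\<close>, or incomparable with both. In the first two cases regularity makes the
  weak bounds strict, so no entry falls into \<open>{x j..x i}\<close>; the same bounds give
  dominance after the exchange along relations to \<open>i\<close> and \<open>j\<close>.\<close>

lemma exchangeable_iff:
  assumes x: "x \<in> D"
  shows "exchangeable x i j \<longleftrightarrow> cover_step m x i j \<and> x \<circ> transpose i j \<in> D"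
proof
  let ?z = "x \<circ> transpose i j"
  assume e: "exchangeable x i j"
  have ij: "i \<in> {1..m}" "j \<in> {1..m}" "i < A j" "x j < x i"
    using e by (simp_all add: exchangeable_def)
  have between: "(A l \<le> i \<longrightarrow> x l \<le> x j) \<and> (A j \<le> l \<longrightarrow> x i \<le> x l) \<and>
      (i < A l \<and> l < A j \<longrightarrow> x l \<notin> {x j..x i})" if "i < l" "l < j" for l
    using e that unfolding exchangeable_def by (meson greaterThanLessThan_iff)
  have below: "x l \<le> x j" if "i < l" "l < j" "A l \<le> i" for l
    using between[OF that(1,2)] that(3) by blast
  have above: "x i \<le> x l" if "i < l" "l < j" "A j \<le> l" for l
    using between[OF that(1,2)] that(3) by blast
  have apart: "x l \<notin> {x j..x i}" if "i < l" "l < j" "i < A l" "l < A j" for l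
    using between[OF that(1,2)] that(3,4) by blast
  have "i < j" using ij(3) A_bounds[OF ij(2)] by linarith
  have "x l \<notin> {x j..x i}" if l: "i < l" "l < j" for l
  proof -
    have ne: "x l \<noteq> x i" "x l \<noteq> x j"
      using l ij eq_W_iff[OF D_W[OF x]] by auto
    consider "A l \<le> i" | "A j \<le> l" | "i < A l" "l < A j" by linarith
    then show ?thesis
      using below[OF l] above[OF l] apart[OF l] ne ij(4) by cases auto
  qed
  then have cs: "cover_step m x i j"
    using ij \<open>i < j\<close> by (simp add: cover_step_def)
  have z: "?z i = x j" "?z j = x i" "\<And>l. l \<noteq> i \<Longrightarrow> l \<noteq> j \<Longrightarrow> ?z l = x l"
    by (auto simp: transpose_def)
  have less: "?z k \<le> ?z l" if k: "k \<in> {1..m}" and l: "A k \<le> l" "l < k" for k l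
  proof -
    have dom: "x k < x l" using D_dominant_less[OF x k l] .
    consider "k = i" | "k = j" | "k \<noteq> i" "k \<noteq> j" "l = i" | "k \<noteq> i" "k \<noteq> j" "l = j"
      | "k \<noteq> i" "k \<noteq> j" "l \<noteq> i" "l \<noteq> j" by blast
    then show ?thesis
    proof cases
      case 1
      then show ?thesis using dom ij \<open>i < j\<close> l z(3)[of l] z(1) by (simp del: o_apply)
    next
      case 2
      then have "i < l" using ij l by simp
      then show ?thesis using above[of l] 2 z l by (simp del: o_apply)
    next
      case 3
      \<comment> \<open>\<open>k\<close> is below \<open>i\<close>. Once it is beyond
        \<open>j\<close>, its interval \<open>{A k..k}\<close> contains \<open>j\<close> as well and
        dominance of \<open>x\<close> applies.\<close>
      have "x k \<le> x j"
      proof (cases "k < j")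
        case True
        then show ?thesis using below[of k] 3 l by simp
      next
        case False
        then show ?thesis using D_dominant[OF x k, of j] 3 l \<open>i < j\<close> by simp
      qed
      then show ?thesis using 3 z by (simp del: o_apply)
    next
      case 4
      then show ?thesis using z dom ij by (simp del: o_apply)
    next
      case 5
      then show ?thesis using z dom by (simp del: o_apply)
    qed
  qed
  have "?z k \<le> ?z l" if "k \<in> {1..m}" "l \<in> {A k..k}" for k l
  proof (cases "l = k")
    case False
    then show ?thesis using that by (intro less) auto
  qed (simp only: order_refl)
  then have "dominant ?z" unfolding dominant_def by blast
  then show "cover_step m x i j \<and> ?z \<in> D"
    using cs transpose_W[OF D_W[OF x]] ij by (simp add: D_def)
next
  let ?z = "x \<circ> transpose i j"
  assume *: "cover_step m x i j \<and> ?z \<in> D"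
  then have cs: "i \<in> {1..m}" "j \<in> {1..m}" "i < j" "x j < x i"
    and btw: "\<forall>l\<in>{i<..<j}. x l \<notin> {x j..x i}"
    and z: "?z \<in> D" by (simp_all add: cover_step_def)
  have "i < A j" using cover_step_D_incomparable[OF x z] * by blast
  moreover have "A l \<le> i \<longrightarrow> x l \<le> x j" "A j \<le> l \<longrightarrow> x i \<le> x l" if l: "l \<in> {i<..<j}" for l
    using D_dominant[OF z, of l i] D_dominant[OF z, of j l] l cs(1,2)
    by (auto simp: transpose_def split: if_splits)
  ultimately show "exchangeable x i j"
    unfolding exchangeable_def using cs btw by blast
qed

section \<open>The greedy step towards a larger dominant element\<close>

lemma first_difference:
  assumes x: "x \<in> D" and y: "y \<in> D" and le: "prefix_le x y"
    and i: "i \<in> {1..m}" and eq: "\<And>l. l \<in> {1..m} \<Longrightarrow> l < A i \<Longrightarrow> x l = y l"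
  shows "y i \<le> x i"
proof (rule ccontr)
  assume "\<not> y i \<le> x i"
  note Ai = A_bounds[OF i]
  \<comment> \<open>By dominance all entries of \<open>y\<close> on \<open>{A i..i}\<close> reach
    \<open>y i\<close>, while \<open>x i\<close> leaves a gap in the block of \<open>x\<close>. Left
    of the block the counts agree, so the counting criterion fails at \<open>i\<close>.\<close>
  have "prefix_count y i (y i) = prefix_count y (A i - 1) (y i) + (i - (A i - 1))"
    using D_dominant[OF y i] Ai by (intro prefix_count_full) auto
  moreover have "prefix_count x i (y i) < prefix_count x (A i - 1) (y i) + (i - (A i - 1))"
    using \<open>\<not> y i \<le> x i\<close> Ai by (intro prefix_count_not_full[of _ i]) auto
  moreover have "prefix_count x (A i - 1) (y i) = prefix_count y (A i - 1) (y i)"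
    unfolding prefix_count_def using eq i Ai by (intro sum.cong) auto
  moreover have "prefix_count y i (y i) \<le> prefix_count x i (y i)"
    using le by (simp add: prefix_le_def)
  ultimately show False by simp
qed

lemma exists_first_difference:
  assumes "x \<in> W" "y \<in> W" "x \<noteq> y"
  obtains i where "i \<in> {1..m}" "x i \<noteq> y i" "\<And>l. l \<in> {1..m} \<Longrightarrow> before l i \<Longrightarrow> x l = y l"
proof -
  let ?X = "{l \<in> {1..m}. x l \<noteq> y l}"
  have "\<exists>l. l \<in> ?X" using ext_W[OF assms(1,2)] assms(3) by blast
  \<comment> \<open>\<open>pair_label\<close> with its second component held constant is a numerical
    form of preorder.\<close>
  then obtain i where i: "i \<in> ?X" and least: "\<And>l. l \<in> ?X \<Longrightarrow> pair_label i 1 \<le> pair_label l 1"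
    using ex_has_least_nat[of "\<lambda>l. l \<in> ?X" _ "\<lambda>l. pair_label l 1"] by blast
  have "x l = y l" if l: "l \<in> {1..m}" "before l i" for l
  proof (rule ccontr)
    assume "x l \<noteq> y l"
    moreover have "pair_label l 1 < pair_label i 1"
      using l i by (subst pair_label_less) auto
    ultimately show False using least[of l] l by simp
  qed
  then show thesis using i that by blast
qed

text \<open>The value \<open>y i\<close> occurs in \<open>x\<close> at some \<open>l\<close>. This
  \<open>l\<close> does not precede \<open>i\<close>, where \<open>x\<close> and \<open>y\<close>
  agree; it is not in \<open>{A i..i}\<close>, where entries of \<open>x\<close> are at least
  \<open>x i\<close>; it is not below \<open>i\<close>, since such positions precede
  \<open>i\<close>. So \<open>l\<close> is an admissible partner, and \<open>j\<close> is the
  nearest one.\<close>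

lemma greedy_exists:
  assumes x: "x \<in> D" and y: "y \<in> D" and le: "prefix_le x y" and ne: "x \<noteq> y"
  obtains i j where "greedy x y i j"
proof -
  obtain i where i: "i \<in> {1..m}" "x i \<noteq> y i"
    and eq: "\<And>l. l \<in> {1..m} \<Longrightarrow> before l i \<Longrightarrow> x l = y l"
    using exists_first_difference[OF D_W[OF x] D_W[OF y] ne] by metis
  have left: "before l i" if "l \<in> {1..m}" "l < A i" for l
    using before_right[OF that] .
  have "y i < x i"
    using first_difference[OF x y le i(1)] eq left i(2) by force
  have "y i \<in> x ` {1..m}"
    using i(1) image_W[OF D_W[OF x]] image_W[OF D_W[OF y]] by auto
  then obtain l where l: "l \<in> {1..m}" "x l = y i" by auto
  have "\<not> before l i"
    using eq[OF l(1)] l eq_W_iff[OF D_W[OF y], of l i] i before_irrefl by metis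
  have "i < l"
  proof (rule ccontr)
    assume "\<not> i < l"
    then have "A i \<le> l" using left[OF l(1)] \<open>\<not> before l i\<close> by force
    then have "x i \<le> x l" using D_dominant[OF x i(1)] \<open>\<not> i < l\<close> by simp
    then show False using l \<open>y i < x i\<close> by simp
  qed
  moreover have "i < A l"
  proof (rule ccontr)
    assume "\<not> i < A l"
    then have "A l \<le> A i" using A_laminar[OF l(1)] \<open>i < l\<close> by simp
    then show False using \<open>\<not> before l i\<close> \<open>i < l\<close> by (auto simp: before_def)
  qed
  ultimately have ex: "\<exists>j. j \<in> {1..m} \<and> i < A j \<and> y i \<le> x j \<and> x j < x i"
    using l \<open>y i < x i\<close> by (metis order_refl)
  define j where "j = (LEAST j. j \<in> {1..m} \<and> i < A j \<and> y i \<le> x j \<and> x j < x i)"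
  have "j \<in> {1..m} \<and> i < A j \<and> y i \<le> x j \<and> x j < x i"
    unfolding j_def by (rule LeastI_ex[OF ex])
  moreover have "\<not> (i < A k \<and> y i \<le> x k \<and> x k < x i)" if "k \<in> {i<..<j}" for k
  proof -
    have "k < j" "k \<in> {1..m}" using that calculation i by auto
    then show ?thesis
      using not_less_Least[of k "\<lambda>j. j \<in> {1..m} \<and> i < A j \<and> y i \<le> x j \<and> x j < x i"]
      unfolding j_def by blast
  qed
  ultimately have "greedy x y i j"
    unfolding greedy_def using i eq by blast
  then show thesis using that by blast
qed

text \<open>A position below \<open>i\<close> precedes \<open>i\<close> in preorder, so
  \<open>x\<close> and \<open>y\<close> agree there and dominance of \<open>y\<close> puts the entry
  under \<open>y i\<close>. The remaining positions are governed by the choice of \<open>j\<close>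
  as nearest partner.\<close>

lemma greedy_between:
  assumes x: "x \<in> D" and y: "y \<in> D" and g: "greedy x y i j" and l: "i < l" "l < j"
  shows "x l < y i \<or> i < A l \<and> x i < x l"
proof -
  note gD = greedyD[OF g]
  have lm: "l \<in> {1..m}" using l gD(1,2) by simp
  show ?thesis
  proof (cases "i < A l")
    case True
    have "x l \<noteq> x i"
      using eq_W_iff[OF D_W[OF x] lm gD(1)] l by simp
    then show ?thesis using True gD(8)[OF l True] by linarith
  next
    case False
    then have "before l i"
      using A_laminar[OF lm, of i] l by (auto simp: before_def)
    then have "x l = y l" by (rule gD(7)[OF lm])
    moreover have "y l < y i" using D_dominant_less[OF y lm] False l by simp
    ultimately show ?thesis by simp
  qed
qed

lemma greedy_exchangeable:
  assumes x: "x \<in> D" and y: "y \<in> D" and g: "greedy x y i j"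
  shows "exchangeable x i j"
proof -
  note gD = greedyD[OF g]
  have "(A l \<le> i \<longrightarrow> x l \<le> x j) \<and> (A j \<le> l \<longrightarrow> x i \<le> x l) \<and>
      (i < A l \<and> l < A j \<longrightarrow> x l \<notin> {x j..x i})" if l: "l \<in> {i<..<j}" for l
    using greedy_between[OF x y g, of l] D_dominant_less[OF x gD(2), of l] gD(5) l by auto
  then show ?thesis
    unfolding exchangeable_def using gD(1,2,3,6) by blast
qed

lemma
  assumes x: "x \<in> D" and y: "y \<in> D" and g: "greedy x y i j"
  shows greedy_cover_step: "cover_step m x i j"
    and greedy_D: "x \<circ> transpose i j \<in> D"
  using exchangeable_iff[OF x] greedy_exchangeable[OF assms] by blast+

text \<open>Counts drop only for \<open>i \<le> p < j\<close> and \<open>x j < q \<le> x i\<close>,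
  where a strict inequality is needed. Entries of \<open>x\<close> from \<open>y i\<close> up to
  below \<open>q\<close> in the prefix lie left of \<open>A i\<close>, where \<open>y\<close>
  agrees, and \<open>y\<close> has one more at \<open>i\<close>. Removing them from the counts at
  threshold \<open>y i\<close> gives strictness at \<open>q\<close>.\<close>

lemma greedy_prefix_le:
  assumes x: "x \<in> D" and y: "y \<in> D" and le: "prefix_le x y" and g: "greedy x y i j"
  shows "prefix_le (x \<circ> transpose i j) y"
  unfolding prefix_le_def
proof (intro allI)
  fix p q
  have ij: "i \<in> {1..m}" "j \<in> {1..m}" "i < j" "x j < x i" "y i \<le> x j"
    and eq: "\<And>l. l \<in> {1..m} \<Longrightarrow> before l i \<Longrightarrow> x l = y l"
    using greedyD[OF g] by blast+
  note tr = prefix_count_transpose[of i j x p q]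
  have le': "prefix_count y p q' \<le> prefix_count x p q'" for q'
    using le by (simp add: prefix_le_def)
  show "prefix_count y p q \<le> prefix_count (x \<circ> transpose i j) p q"
  proof (cases "i \<le> p \<and> p < j \<and> x j < q \<and> q \<le> x i")
    case False
    then show ?thesis using tr le'[of q] ij by auto
  next
    case True
    have pointwise: "y i \<le> y l \<and> y l < q" if l: "l \<in> {1..p}" "y i \<le> x l" "x l < q" for l
    proof -
      have lm: "l \<in> {1..m}" using l True ij by auto
      have "l < A i"
      proof (rule ccontr)
        assume "\<not> l < A i"
        then have "l \<le> i \<Longrightarrow> False" using D_dominant[OF x ij(1), of l] l True by simp
        moreover have "i < l \<Longrightarrow> False"
          using greedy_between[OF x y g, of l] l True by simp
        ultimately show False by force
      qed
      then have "x l = y l" using eq[OF lm] before_right[OF lm] by simp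
      then show ?thesis using l by simp
    qed
    have "(\<Sum>l\<in>{1..p}. of_bool (y i \<le> x l \<and> x l < q)) <
      (\<Sum>l\<in>{1..p}. of_bool (y i \<le> y l \<and> y l < q) :: nat)"
    proof (rule sum_strict_mono_ex1)
      show "\<forall>l\<in>{1..p}. of_bool (y i \<le> x l \<and> x l < q) \<le> (of_bool (y i \<le> y l \<and> y l < q) :: nat)"
        using pointwise by auto
      show "\<exists>l\<in>{1..p}. of_bool (y i \<le> x l \<and> x l < q) < (of_bool (y i \<le> y l \<and> y l < q) :: nat)"
        using True ij by (intro bexI[of _ i]) auto
    qed simp
    moreover have "y i \<le> q" using True ij by simp
    ultimately have "prefix_count y p q < prefix_count x p q"
      using le'[of "y i"] prefix_count_split[of "y i" q y p] prefix_count_split[of "y i" q x p]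
      by linarith
    moreover have "of_bool (i \<le> p \<and> p < j \<and> x j < q \<and> q \<le> x i) = (1 :: nat)"
      using True by simp
    ultimately show ?thesis using tr ij by simp
  qed
qed

text \<open>Iterated greedy steps lead from \<open>x\<close> to \<open>y\<close>; each adds one
  inversion, and \<open>m * m\<close> bounds their number.\<close>

lemma prefix_le_imp_bruhat_steps:
  assumes "x \<in> D" "y \<in> D" "prefix_le x y"
  shows "(x, y) \<in> (bruhat_steps m)\<^sup>*" and "inversions m x \<le> inversions m y"
    and "x \<noteq> y \<Longrightarrow> inversions m x < inversions m y"
proof -
  have "(x, y) \<in> (bruhat_steps m)\<^sup>* \<and> inversions m x \<le> inversions m y \<and>
    (x \<noteq> y \<longrightarrow> inversions m x < inversions m y)"
    using assms
  proof (induction "m * m - inversions m x" arbitrary: x rule: less_induct)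
    case less
    show ?case
    proof (cases "x = y")
      case False
      then obtain i j where g: "greedy x y i j" using greedy_exists less.prems by metis
      let ?z = "x \<circ> transpose i j"
      have c: "cover_step m x i j" using greedy_exchangeable[OF less.prems(1,2) g] exchangeable_iff[OF less.prems(1)] by blast
      note inv = inversions_cover_step[OF c]
      have "m * m - inversions m ?z < m * m - inversions m x"
        using inv inversions_le[of m ?z] by linarith
      then have "(?z, y) \<in> (bruhat_steps m)\<^sup>* \<and> inversions m ?z \<le> inversions m y"
        using less.hyps greedy_D greedy_prefix_le less.prems g by blast
      then show ?thesis
        using inv converse_rtrancl_into_rtrancl[OF cover_step_bruhat_steps[OF c]] by simp
    qed simp
  qed
  then show "(x, y) \<in> (bruhat_steps m)\<^sup>*" "inversions m x \<le> inversions m y"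
    "x \<noteq> y \<Longrightarrow> inversions m x < inversions m y" by blast+
qed

end

subsection \<open>The EL-labelling\<close>

lemma maximal_chain_single: "maximal_chain P r x y [a] \<longleftrightarrow> a = x \<and> a = y \<and> a \<in> P"
  by (auto simp: maximal_chain_def)

lemma maximal_chain_Cons:
  "maximal_chain P r x y (a # b # c) \<longleftrightarrow> a = x \<and> covers P r x b \<and> maximal_chain P r b y (b # c)"
  by (auto simp: maximal_chain_def covers_def)

lemma maximal_chain_cases:
  assumes "maximal_chain P r x y c"
  obtains "c = [x]" "x = y" "x \<in> P"
    | z c' where "c = x # z # c'" "covers P r x z" "maximal_chain P r z y (z # c')"
proof -
  consider "c = []" | a where "c = [a]" | a b c' where "c = a # b # c'"
    by (metis list.exhaust)
  then show thesis
  proof cases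
    case 1
    then show thesis using assms by (simp add: maximal_chain_def)
  next
    case 2
    then show thesis using assms that(1) by (auto simp: maximal_chain_single)
  next
    case 3
    then show thesis using assms that(2) by (auto simp: maximal_chain_Cons)
  qed
qed

lemma maximal_chain_ends:
  assumes "maximal_chain P r x y c"
  shows "x \<in> P" "y \<in> P"
  using assms unfolding maximal_chain_def by (auto dest: hd_in_set last_in_set)

lemma label_word_single [simp]: "label_word lab [a] = []"
  by (simp add: label_word_def)

lemma label_word_Cons [simp]: "label_word lab (a # b # c) = lab a b # label_word lab (b # c)"
  by (simp add: label_word_def)

section \<open>The counting criterion on all rearrangements\<close>

context regular_weight
begin

lemma
  assumes "x \<in> W" "y \<in> W"
  shows bruhat_iff: "(x, y) \<in> bruhat m lam \<longleftrightarrow> prefix_le x y"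
    and inversions_mono: "prefix_le x y \<Longrightarrow> inversions m x \<le> inversions m y"
    and inversions_strict_mono: "prefix_le x y \<Longrightarrow> x \<noteq> y \<Longrightarrow> inversions m x < inversions m y"
proof -
  \<comment> \<open>With \<open>A k = k\<close> no two positions are comparable, so every
    rearrangement is dominant.\<close>
  interpret antichain: forest m lam "\<lambda>k. k"
    by unfold_locales auto
  have "antichain.D = W"
    by (auto simp: antichain.D_def antichain.dominant_def)
  then have D: "x \<in> antichain.D" "y \<in> antichain.D" using assms by simp_all
  show "(x, y) \<in> bruhat m lam \<longleftrightarrow> prefix_le x y"
    using antichain.prefix_le_imp_bruhat_steps(1)[OF D] bruhat_steps_imp_prefix_le[of x y m] assms
    by (auto simp: bruhat_def)
  show "prefix_le x y \<Longrightarrow> inversions m x \<le> inversions m y"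
    by (rule antichain.prefix_le_imp_bruhat_steps(2)[OF D])
  show "prefix_le x y \<Longrightarrow> x \<noteq> y \<Longrightarrow> inversions m x < inversions m y"
    by (rule antichain.prefix_le_imp_bruhat_steps(3)[OF D])
qed

lemma cover_step_prefix_le: "cover_step m x i j \<Longrightarrow> prefix_le x (x \<circ> transpose i j)"
  by (rule prefix_le_transpose) (auto simp: cover_step_def)

end

context forest
begin

definition ord :: "(nat \<Rightarrow> nat) rel" where
  "ord = {(x, y). x \<in> D \<and> y \<in> D \<and> prefix_le x y}"

text \<open>A label depends on the endpoints of an edge only, so the exchanged positions are
  recovered as the extreme points of difference.\<close>

definition edge_label :: "(nat \<Rightarrow> nat) \<Rightarrow> (nat \<Rightarrow> nat) \<Rightarrow> nat" where
  "edge_label a b = pair_label (Min {l. a l \<noteq> b l}) (Max {l. a l \<noteq> b l})"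

abbreviation "labels \<equiv> label_word edge_label"

lemma edge_label_cover_step:
  assumes "cover_step m x i j"
  shows "edge_label x (x \<circ> transpose i j) = pair_label i j"
proof -
  have "i < j" "x j < x i" using assms by (simp_all add: cover_step_def)
  then have "{l. x l \<noteq> (x \<circ> transpose i j) l} = {i, j}"
    by (auto simp: transpose_def)
  then show ?thesis
    using \<open>i < j\<close> by (simp add: edge_label_def)
qed

text \<open>The greedy step from \<open>a\<close> towards \<open>b\<close> stays in the interval,
  hence reaches \<open>b\<close> if \<open>b\<close> covers \<open>a\<close>. Conversely a single
  new inversion leaves no room strictly between.\<close>

lemma covers_ord_iff:
  "covers D ord a b \<longleftrightarrow> a \<in> D \<and> b \<in> D \<and> (\<exists>i j. cover_step m a i j \<and> b = a \<circ> transpose i j)"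
proof
  assume c: "covers D ord a b"
  then have ab: "a \<in> D" "b \<in> D" "prefix_le a b" "a \<noteq> b"
    and no: "\<And>z. z \<in> D \<Longrightarrow> prefix_le a z \<Longrightarrow> a \<noteq> z \<Longrightarrow> prefix_le z b \<Longrightarrow> z = b"
    unfolding covers_def ord_def by auto
  obtain i j where g: "greedy a b i j" using greedy_exists[OF ab] .
  let ?z = "a \<circ> transpose i j"
  have cs: "cover_step m a i j" using greedy_cover_step[OF ab(1,2) g] .
  have "inversions m ?z \<noteq> inversions m a" using inversions_cover_step[OF cs] by simp
  then have "?z = b"
    using no[OF greedy_D[OF ab(1,2) g] cover_step_prefix_le[OF cs] _ greedy_prefix_le[OF ab(1-3) g]]
    by metis
  then show "a \<in> D \<and> b \<in> D \<and> (\<exists>i j. cover_step m a i j \<and> b = a \<circ> transpose i j)"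
    using ab cs by blast
next
  assume "a \<in> D \<and> b \<in> D \<and> (\<exists>i j. cover_step m a i j \<and> b = a \<circ> transpose i j)"
  then obtain i j where ab: "a \<in> D" "b \<in> D" and cs: "cover_step m a i j"
    and b: "b = a \<circ> transpose i j" by blast
  have inv: "inversions m b = Suc (inversions m a)"
    using inversions_cover_step[OF cs] b by simp
  have "z = b" if "z \<in> D" "prefix_le a z" "a \<noteq> z" "prefix_le z b" for z
    using inversions_strict_mono[OF D_W[OF ab(1)] D_W[OF that(1)] that(2,3)]
      inversions_strict_mono[OF D_W[OF that(1)] D_W[OF ab(2)] that(4)] inv by linarith
  then show "covers D ord a b"
    using ab cover_step_prefix_le[OF cs] b inv unfolding covers_def ord_def by auto
qed

lemma coversE:
  assumes "covers D ord x z"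
  obtains i j where "x \<in> D" "z \<in> D" "cover_step m x i j" "z = x \<circ> transpose i j" "i < A j"
    "edge_label x z = pair_label i j" "inversions m z = Suc (inversions m x)" "prefix_le x z"
proof -
  obtain i j where *: "x \<in> D" "z \<in> D" "cover_step m x i j" "z = x \<circ> transpose i j"
    using assms unfolding covers_ord_iff by blast
  show thesis
    using that[OF *] cover_step_D_incomparable[of x i j] edge_label_cover_step[OF *(3)]
      inversions_cover_step[OF *(3)] cover_step_prefix_le[OF *(3)] * by blast
qed

text \<open>Each cover adds one inversion, which fixes the length of all maximal chains with given
  ends.\<close>

lemma maximal_chain_length_prefix_le:
  "maximal_chain D ord x y c \<Longrightarrow> length c + inversions m x = Suc (inversions m y) \<and> prefix_le x y"
proof (induction c arbitrary: x)
  case Nil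
  then show ?case by (simp add: maximal_chain_def)
next
  case (Cons a c)
  from Cons.prems show ?case
  proof (cases rule: maximal_chain_cases)
    case (2 z c')
    obtain i j where *: "inversions m z = Suc (inversions m x)" "prefix_le x z"
      using coversE[OF 2(2)] by metis
    then show ?thesis using Cons.IH[of z] 2 prefix_le_trans[of x z y] by simp
  qed simp
qed

text \<open>For a competing exchange of smaller label, everything left of \<open>A i'\<close> still
  agrees with \<open>y\<close>, so \<open>first_difference\<close> forces
  \<open>y i' \<le> x j'\<close>. Yet \<open>x j' < y i'\<close>: if \<open>i'\<close> precedes
  \<open>i\<close>, because \<open>y i' = x i'\<close>; if \<open>i' = i\<close>, by
  \<open>greedy_between\<close>, as \<open>j' < j\<close>.\<close>

lemma greedy_minimal:
  assumes x: "x \<in> D" and y: "y \<in> D" and g: "greedy x y i j"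
    and cs: "cover_step m x i' j'" and z: "x \<circ> transpose i' j' \<in> D"
    and le: "prefix_le (x \<circ> transpose i' j') y"
  shows "pair_label i j < pair_label i' j' \<or> i' = i \<and> j' = j"
proof (rule ccontr)
  let ?z = "x \<circ> transpose i' j'"
  assume not: "\<not> ?thesis"
  note gD = greedyD[OF g]
  have ij': "i' \<in> {1..m}" "j' \<in> {1..m}" "i' < j'" "x j' < x i'"
    using cs by (simp_all add: cover_step_def)
  have cases: "before i' i \<or> i' = i \<and> j' < j"
    using not pair_label_less[OF gD(1,2) ij'(1,2)] before_total[of i i'] by auto
  have "x l = y l" if "l \<in> {1..m}" "l < A i'" for l
    using that cases gD(7)[OF that(1)] before_right[OF that] before_trans by blast
  moreover have "?z l = x l" if "l < A i'" for l
    using that A_bounds[OF ij'(1)] ij'(3) by (simp add: transpose_def)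
  ultimately have "y i' \<le> ?z i'"
    by (intro first_difference[OF z y le ij'(1)]) (simp del: o_apply)
  then have "y i' \<le> x j'" by simp
  moreover have "x j' < y i'"
    using cases
  proof
    assume "before i' i"
    then show ?thesis using gD(7)[OF ij'(1)] ij' by simp
  next
    assume "i' = i \<and> j' < j"
    then show ?thesis using greedy_between[OF x y g, of j'] ij' by auto
  qed
  ultimately show False by simp
qed

text \<open>The second exchange cannot start before \<open>i\<close>, where agreement with
  \<open>y\<close> is settled. If it starts at \<open>i\<close> again, entries between
  \<open>i\<close> and \<open>j\<close> are under \<open>y i\<close> or above \<open>x i\<close>,
  and \<open>j\<close> now carries \<open>x i\<close>, so the partner lies beyond
  \<open>j\<close>.\<close>

lemma greedy_increasing:
  assumes x: "x \<in> D" and y: "y \<in> D" and g: "greedy x y i j"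
    and g': "greedy (x \<circ> transpose i j) y i' j'"
  shows "pair_label i j < pair_label i' j'"
proof -
  let ?z = "x \<circ> transpose i j"
  note gD = greedyD[OF g] and gD' = greedyD[OF g']
  have "\<not> before i' i"
  proof
    assume b: "before i' i"
    then have "i' \<noteq> i" "i' \<noteq> j"
      using before_right[OF gD(1,3)] before_irrefl before_trans by blast+
    then have "?z i' = y i'" using gD(7)[OF gD'(1) b] by simp
    then show False using gD'(5,6) by simp
  qed
  then consider "before i i'" | "i' = i" using before_total by blast
  then show ?thesis
  proof cases
    case 2
    have "j < j'"
    proof (rule ccontr)
      assume "\<not> j < j'"
      then consider "j' = j" | "j' < j" by linarith
      then show False
      proof cases
        case 1
        then show False using gD'(6) gD(4,6) 2 by simp
      next
        case b: 2
        then have "?z j' = x j'" "?z i' = x j" using gD'(4) 2 by (simp_all add: transpose_def)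
        then show False using greedy_between[OF x y g, of j'] gD'(4,5,6) gD(6) 2 b by simp
      qed
    qed
    then show ?thesis using 2 pair_label_less[OF gD(1,2) gD'(1,2)] by simp
  qed (simp add: pair_label_less[OF gD(1,2) gD'(1,2)])
qed

text \<open>Greedy steps are repeated until \<open>y\<close>. The third conjunct exposes the first
  label so that the induction can compare it with the preceding one; minimality of the word comes
  edge by edge from \<open>greedy_minimal\<close>.\<close>

lemma increasing_chain_exists:
  assumes "x \<in> D" "y \<in> D" "prefix_le x y"
  shows "\<exists>c. maximal_chain D ord x y c \<and> sorted_wrt (<) (labels c) \<and>
    (x \<noteq> y \<longrightarrow> (\<exists>i j w. greedy x y i j \<and> labels c = pair_label i j # w)) \<and>
    (\<forall>c'. maximal_chain D ord x y c' \<longrightarrow> (labels c, labels c') \<in> (lexord {(k, l). k < l})\<^sup>=)"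
  using assms
proof (induction "m * m - inversions m x" arbitrary: x rule: less_induct)
  case less
  note x = less.prems(1) and y = less.prems(2)
  show ?case
  proof (cases "x = y")
    case True
    have "c' = [x]" if "maximal_chain D ord x y c'" for c'
      using maximal_chain_length_prefix_le[OF that] True
      by (cases rule: maximal_chain_cases[OF that]) auto
    then show ?thesis
      using True x by (intro exI[of _ "[x]"]) (auto simp: maximal_chain_single)
  next
    case False
    then obtain i j where g: "greedy x y i j" using greedy_exists less.prems by metis
    let ?z = "x \<circ> transpose i j"
    have cs: "cover_step m x i j" using greedy_cover_step[OF x y g] .
    have z: "?z \<in> D" "prefix_le ?z y"
      using greedy_D[OF x y g] greedy_prefix_le[OF less.prems g] .
    have "m * m - inversions m ?z < m * m - inversions m x"
      using inversions_cover_step[OF cs] inversions_le[of m ?z] by linarith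
    from less.hyps[OF this z(1) y z(2)] obtain c where
      c: "maximal_chain D ord ?z y c" "sorted_wrt (<) (labels c)"
        "?z \<noteq> y \<Longrightarrow> \<exists>i j w. greedy ?z y i j \<and> labels c = pair_label i j # w"
        and lex: "\<And>c'. maximal_chain D ord ?z y c' \<Longrightarrow>
          (labels c, labels c') \<in> (lexord {(k, l). k < l})\<^sup>="
      by blast
    obtain c1 where c1: "c = ?z # c1"
      using c(1) by (cases rule: maximal_chain_cases) auto
    have lab: "labels (x # c) = pair_label i j # labels c"
      using c1 edge_label_cover_step[OF cs] by simp
    have cov: "covers D ord x ?z" unfolding covers_ord_iff using x z cs by blast
    then have mc: "maximal_chain D ord x y (x # c)"
      using c(1) c1 by (simp add: maximal_chain_Cons)
    have sorted: "sorted_wrt (<) (labels (x # c))"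
    proof (cases "?z = y")
      case True
      have "c = [?z]"
        using c(1) maximal_chain_length_prefix_le[OF c(1)] True
        by (cases rule: maximal_chain_cases) auto
      then show ?thesis using lab by simp
    next
      case False
      then obtain i' j' w where w: "greedy ?z y i' j'" "labels c = pair_label i' j' # w"
        using c(3) by blast
      then show ?thesis
        using c(2) greedy_increasing[OF x y g w(1)] by (auto simp: lab w(2))
    qed
    have "(labels (x # c), labels c') \<in> (lexord {(k, l). k < l})\<^sup>="
      if c': "maximal_chain D ord x y c'" for c'
      using c'
    proof (cases rule: maximal_chain_cases)
      case 1
      then show ?thesis using False by simp
    next
      case (2 z' c2)
      obtain i' j' where z': "z' \<in> D" "cover_step m x i' j'" "z' = x \<circ> transpose i' j'"
        "edge_label x z' = pair_label i' j'"
        using coversE[OF 2(2)] by metis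
      have "prefix_le z' y" using maximal_chain_length_prefix_le[OF 2(3)] by blast
      then have "pair_label i j < pair_label i' j' \<or> i' = i \<and> j' = j"
        using greedy_minimal[OF x y g z'(2)] z'(1,3) by simp
      then show ?thesis
      proof
        assume "pair_label i j < pair_label i' j'"
        then show ?thesis using 2(1) z'(4) lab by simp
      next
        assume "i' = i \<and> j' = j"
        then show ?thesis using lex[of "z' # c2"] 2(1,3) z'(3,4) lab by auto
      qed
    qed
    then show ?thesis using mc sorted g lab by blast
  qed
qed

text \<open>\<open>pair_label i m\<close> is the largest label starting at \<open>i\<close>, so all
  exchanges start after \<open>i\<close> in preorder. Their partners come later still, and the entry
  at \<open>i\<close> is never touched.\<close>

lemma later_labels_fix:
  "maximal_chain D ord z y c \<Longrightarrow> i \<in> {1..m} \<Longrightarrow> (\<And>k. k \<in> set (labels c) \<Longrightarrow> pair_label i m < k) \<Longrightarrow>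
    y i = z i"
proof (induction c arbitrary: z)
  case Nil
  then show ?case by (simp add: maximal_chain_def)
next
  case (Cons a c)
  from Cons.prems(1) show ?case
  proof (cases rule: maximal_chain_cases)
    case (2 z' c')
    obtain i' j' where z': "cover_step m z i' j'" "z' = z \<circ> transpose i' j'" "i' < A j'"
      "edge_label z z' = pair_label i' j'"
      using coversE[OF 2(2)] by metis
    have ij': "i' \<in> {1..m}" "j' \<in> {1..m}" using z'(1) by (simp_all add: cover_step_def)
    have m: "m \<in> {1..m}" using Cons.prems(2) by simp
    have "y i = z' i"
      using Cons.IH[of z'] Cons.prems(2,3) 2 by simp
    moreover have "before i i'"
      using Cons.prems(3)[of "pair_label i' j'"] 2(1) z'(4) ij'
        pair_label_less[OF Cons.prems(2) m ij'] by auto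
    then have "i \<noteq> i'" "i \<noteq> j'"
      using before_right[OF ij'(1) z'(3)] before_trans before_irrefl by blast+
    ultimately show ?thesis using z'(2) by simp
  qed simp
qed

text \<open>In an increasing chain the exchanges starting at \<open>i\<close> come first, with
  partners beyond \<open>j\<close>. Each is a Bruhat cover passing over \<open>j\<close>, so the
  entry it brings to \<open>i\<close> still exceeds \<open>z j\<close>; afterwards the entry at
  \<open>i\<close> is final.\<close>

lemma later_labels_less:
  "maximal_chain D ord z y c \<Longrightarrow> sorted_wrt (<) (labels c) \<Longrightarrow> i \<in> {1..m} \<Longrightarrow> j \<in> {1..m} \<Longrightarrow>
    i < j \<Longrightarrow> (\<And>k. k \<in> set (labels c) \<Longrightarrow> pair_label i j < k) \<Longrightarrow> z j < z i \<Longrightarrow> z j < y i"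
proof (induction c arbitrary: z j)
  case Nil
  then show ?case by (simp add: maximal_chain_def)
next
  case (Cons a c)
  from Cons.prems(1) show ?case
  proof (cases rule: maximal_chain_cases)
    case 1
    then show ?thesis using Cons.prems(7) by simp
  next
    case (2 z' c')
    obtain i' j' where z': "cover_step m z i' j'" "z' = z \<circ> transpose i' j'"
      "edge_label z z' = pair_label i' j'"
      using coversE[OF 2(2)] by metis
    have ij': "i' \<in> {1..m}" "j' \<in> {1..m}" "i' < j'" using z'(1) by (simp_all add: cover_step_def)
    have m: "m \<in> {1..m}" using Cons.prems(3) by simp
    have lab: "labels (a # c) = pair_label i' j' # labels c" using 2(1) z'(3) by simp
    have "pair_label i j < pair_label i' j'" using Cons.prems(6) lab by simp
    then consider "before i i'" | "i = i'" "j < j'"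
      using pair_label_less[OF Cons.prems(3,4) ij'(1,2)] by blast
    then show ?thesis
    proof cases
      case 1
      then have "pair_label i m < pair_label i' j'"
        using pair_label_less[OF Cons.prems(3) m ij'(1,2)] by simp
      then have "y i = z i"
        using Cons.prems(2) lab by (intro later_labels_fix[OF Cons.prems(1,3)]) fastforce
      then show ?thesis using Cons.prems(7) by simp
    next
      case b: 2
      have "z j \<notin> {z j'..z i'}" using z'(1) b Cons.prems(5) by (simp add: cover_step_def)
      then have "z j < z j'" using Cons.prems(7) b by simp
      moreover have e: "z' i = z j'" "z' j = z j"
        using z'(2) b Cons.prems(5) by (simp_all add: transpose_def)
      moreover have "z' j < y i"
        using Cons.prems(2-6) 2 lab calculation by (intro Cons.IH) auto
      ultimately show ?thesis by simp
    qed
  qed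
qed

text \<open>Only the greedy edge can open an increasing chain. Any other cover below
  \<open>y\<close> has a larger label, so all labels are larger and \<open>later_labels_less\<close>
  gives \<open>x j < y i\<close>, against the choice of \<open>j\<close>.\<close>

lemma increasing_chain_unique:
  "maximal_chain D ord x y c \<Longrightarrow> maximal_chain D ord x y c' \<Longrightarrow>
    sorted_wrt (<) (labels c) \<Longrightarrow> sorted_wrt (<) (labels c') \<Longrightarrow> c = c'"
proof (induction c arbitrary: x c')
  case Nil
  then show ?case by (simp add: maximal_chain_def)
next
  case (Cons a c)
  have len: "length c' = length (a # c)"
    using Cons.prems(1,2)[THEN maximal_chain_length_prefix_le] by simp
  from Cons.prems(1) show ?case
  proof (cases rule: maximal_chain_cases)
    case 1
    from Cons.prems(2) show ?thesis
      using len 1 by (cases rule: maximal_chain_cases) auto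
  next
    case (2 z d)
    from Cons.prems(2) obtain z' d' where 3: "c' = x # z' # d'" "covers D ord x z'"
      "maximal_chain D ord z' y (z' # d')"
      using len 2(1) by (cases rule: maximal_chain_cases) auto
    have xy: "x \<in> D" "y \<in> D" using maximal_chain_ends[OF Cons.prems(1)] .
    have le: "prefix_le x y" and ne: "x \<noteq> y"
      using maximal_chain_length_prefix_le[OF Cons.prems(1)] 2(1) by auto
    obtain i j where g: "greedy x y i j" using greedy_exists[OF xy le ne] .
    note gD = greedyD[OF g]
    have first: "u = x \<circ> transpose i j"
      if u: "covers D ord x u" "maximal_chain D ord u y (u # e)" "sorted_wrt (<) (labels (x # u # e))"
      for u e
    proof -
      obtain i' j' where u': "u \<in> D" "cover_step m x i' j'" "u = x \<circ> transpose i' j'"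
        "edge_label x u = pair_label i' j'"
        using coversE[OF u(1)] by metis
      have "prefix_le u y" using maximal_chain_length_prefix_le[OF u(2)] by blast
      then have "pair_label i j < pair_label i' j' \<or> i' = i \<and> j' = j"
        using greedy_minimal[OF xy g u'(2)] u'(1,3) by simp
      moreover have "\<not> pair_label i j < pair_label i' j'"
      proof
        assume lt: "pair_label i j < pair_label i' j'"
        have mc: "maximal_chain D ord x y (x # u # e)" using u by (simp add: maximal_chain_Cons)
        have "x j < y i"
          using u(3) u'(4) lt by (intro later_labels_less[OF mc u(3) gD(1,2,4) _ gD(6)]) fastforce
        then show False using gD(5) by simp
      qed
      ultimately show ?thesis using u'(3) by simp
    qed
    have "z = x \<circ> transpose i j"
      using first[OF 2(2,3)] Cons.prems(3) 2(1) by simp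
    moreover have "z' = x \<circ> transpose i j"
      using first[OF 3(2,3)] Cons.prems(4) 3(1) by simp
    ultimately have "z = z'" by simp
    then have "z # d = z' # d'"
      using Cons.IH[of z "z' # d'"] Cons.prems(3,4) 2 3 by simp
    then show ?thesis using 2 3 by simp
  qed
qed

lemma EL_shellable_ord: "EL_shellable D ord"
proof -
  let ?R = "{(k, l). k \<le> l} :: nat rel"
  have R: "?R - Id = {(k, l). k < l}" by auto
  have "partial_order_on UNIV ?R"
    unfolding partial_order_on_def preorder_on_def refl_on_def trans_def antisym_def by auto
  moreover have "EL_labelling D ord ?R edge_label"
    unfolding EL_labelling_def R mem_Collect_eq case_prod_conv
  proof (intro ballI impI)
    fix x y assume "x \<in> D" "y \<in> D" "(x, y) \<in> ord - Id"
    then have "prefix_le x y" by (simp add: ord_def)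
    with increasing_chain_exists[OF \<open>x \<in> D\<close> \<open>y \<in> D\<close>] obtain c where
      "maximal_chain D ord x y c" "sorted_wrt (<) (labels c)"
      "\<forall>c'. maximal_chain D ord x y c' \<longrightarrow> (labels c, labels c') \<in> (lexord {(k, l). k < l})\<^sup>="
      by blast
    then show "\<exists>c. maximal_chain D ord x y c \<and> sorted_wrt (<) (labels c) \<and>
        (\<forall>c'. maximal_chain D ord x y c' \<and> sorted_wrt (<) (labels c') \<longrightarrow> c' = c) \<and>
        (\<forall>c'. maximal_chain D ord x y c' \<longrightarrow> (labels c, labels c') \<in> (lexord {(k, l). k < l})\<^sup>=)"
      using increasing_chain_unique by blast
  qed
  ultimately show ?thesis unfolding EL_shellable_def by blast
qed

lemma graded_ord: "graded_poset D ord"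
  unfolding graded_poset_def
proof (intro ballI impI allI, elim conjE)
  fix x y c c' assume "maximal_chain D ord x y c" "maximal_chain D ord x y c'"
  then show "length c = length c'"
    using maximal_chain_length_prefix_le by (metis add_right_cancel)
qed

end

subsection \<open>Intervals of length two, minimum and maximum\<close>

text \<open>Distinct transpositions are disjoint or compose to a 3-cycle; either way no point of
  their supports stays fixed.\<close>

lemma transpose_transpose_moves:
  fixes i j k l p :: nat
  assumes "i < j" "k < l" "(i, j) \<noteq> (k, l)"
  shows "transpose i j (transpose k l p) \<noteq> p \<longleftrightarrow> p \<in> {i, j, k, l}"
  using assms by (auto simp: transpose_def)

context regular_weight
begin

lemma differences_two_steps:
  assumes x: "x \<in> W" and cs: "cover_step m x i j" "cover_step m (x \<circ> transpose i j) k l"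
  shows "{p. x p \<noteq> (x \<circ> transpose i j \<circ> transpose k l) p} = {i, j, k, l}"
proof -
  let ?U = "{1..m}"
  have ij: "i \<in> ?U" "j \<in> ?U" "i < j" and kl: "k \<in> ?U" "l \<in> ?U" "k < l"
    using cs by (simp_all add: cover_step_def)
  \<comment> \<open>After the first exchange the entries at \<open>i\<close> and \<open>j\<close>
    ascend, so this pair cannot be exchanged upwards again.\<close>
  have ne: "(i, j) \<noteq> (k, l)"
    using cs by (auto simp: cover_step_def)
  have "x p \<noteq> x (transpose i j (transpose k l p)) \<longleftrightarrow> transpose i j (transpose k l p) \<noteq> p" for p
  proof (cases "p \<in> ?U")
    case True
    then have "transpose i j (transpose k l p) \<in> ?U"
      using ij kl by (auto simp: transpose_def)
    then show ?thesis using eq_W_iff[OF x True] by metis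
  next
    case False
    then have "transpose i j (transpose k l p) = p"
      using ij kl by (auto simp: transpose_def)
    then show ?thesis by simp
  qed
  then have "{p. x p \<noteq> (x \<circ> transpose i j \<circ> transpose k l) p} = {p. p \<in> {i, j, k, l}}"
    unfolding o_apply by (simp only: transpose_transpose_moves[OF ij(3) kl(3) ne])
  then show ?thesis by (simp only: Collect_mem_eq)
qed

text \<open>
  If the two transpositions leading from x to y overlap, they move three positions \<open>p < q < r\<close>. The
  three possible first exchanges cannot all be Bruhat covers: those of p, q and of q, r would need
  \<open>x r < x q < x p\<close>, and then the exchange of p and r is not a cover.
\<close>

lemma two_step_interval_le_2:
  assumes x: "x \<in> W"
    and Z: "\<And>z. z \<in> Z \<Longrightarrow> \<exists>i j k l. cover_step m x i j \<and> z = x \<circ> transpose i j \<and>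
              cover_step m z k l \<and> y = z \<circ> transpose k l"
  shows "\<exists>z1 z2. Z \<subseteq> {z1, z2}"
proof (cases "Z = {}")
  case False
  define path where "path i j k l \<longleftrightarrow> cover_step m x i j \<and> cover_step m (x \<circ> transpose i j) k l \<and>
    y = x \<circ> transpose i j \<circ> transpose k l" for i j k l
  define V where "V = {p. x p \<noteq> y p}"
  have V: "V = {i, j, k, l}" if "path i j k l" for i j k l
    using that differences_two_steps[OF x] unfolding path_def V_def by simp
  have lt: "i < j" "k < l" "x j < x i" if "path i j k l" for i j k l
    using that by (simp_all add: path_def cover_step_def)
  have inj: "p = q" if "x p = x q" "p \<in> V" "q \<in> V" "V \<subseteq> {1..m}" for p q
    using that eq_W_iff[OF x] by blast
  obtain z0 where "z0 \<in> Z" using False by blast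
  then obtain i j k l where p0: "path i j k l" using Z[of z0] unfolding path_def by blast
  have sub: "V \<subseteq> {1..m}"
    using p0 V[OF p0] by (auto simp: path_def cover_step_def)
  have repr: "\<exists>a b c d. path a b c d \<and> z = x \<circ> transpose a b" if "z \<in> Z" for z
    using Z[OF that] unfolding path_def by blast
  show ?thesis
  proof (cases "card V = 4")
    \<comment> \<open>The transpositions are disjoint: \<open>y\<close> swaps the entries of
      \<open>x\<close> on two pairs, and every path starts with one of them.\<close>
    case True
    have swap: "y a = x b" "y b = x a" if p: "path a b c d" for a b c d
    proof -
      have "card {a, b, c, d} = 4" using V[OF p] True by simp
      then have "a \<noteq> c" "a \<noteq> d" "b \<noteq> c" "b \<noteq> d"
        using lt[OF p] by (auto simp: card_insert_if split: if_splits)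
      then show "y a = x b" "y b = x a" using p by (auto simp: path_def)
    qed
    have swap2: "y k = x l" "y l = x k"
    proof -
      have "card {i, j, k, l} = 4" using V[OF p0] True by simp
      then have "i \<noteq> k" "i \<noteq> l" "j \<noteq> k" "j \<noteq> l"
        using lt[OF p0] by (auto simp: card_insert_if split: if_splits)
      then show "y k = x l" "y l = x k" using p0 by (auto simp: path_def)
    qed
    have pairs: "(a, b) = (i, j) \<or> (a, b) = (k, l)" if p: "path a b c d" for a b c d
    proof -
      have ab: "a \<in> V" "b \<in> V" using V[OF p] by auto
      consider "a = i" | "a = j" | "a = k" | "a = l" using ab(1) V[OF p0] by blast
      then show ?thesis
      proof cases
        case 1
        then have "x b = x j" using swap(1)[OF p] swap(1)[OF p0] by simp
        then show ?thesis using inj[of b j] ab V[OF p0] sub 1 by simp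
      next
        case 2
        then have "x b = x i" using swap(1)[OF p] swap(2)[OF p0] by simp
        then have "b = i" using inj[of b i] ab V[OF p0] sub by simp
        then show ?thesis using lt[OF p] lt[OF p0] 2 by simp
      next
        case 3
        then have "x b = x l" using swap(1)[OF p] swap2(1) by simp
        then show ?thesis using inj[of b l] ab V[OF p0] sub 3 by simp
      next
        case 4
        then have "x b = x k" using swap(1)[OF p] swap2(2) by simp
        then have "b = k" using inj[of b k] ab V[OF p0] sub by simp
        then show ?thesis using lt[OF p] lt[OF p0] 4 by simp
      qed
    qed
    have "z \<in> {x \<circ> transpose i j, x \<circ> transpose k l}" if z: "z \<in> Z" for z
    proof -
      obtain a b c d where "path a b c d" "z = x \<circ> transpose a b" using repr[OF z] by metis
      then show ?thesis using pairs[of a b c d] by auto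
    qed
    then have "Z \<subseteq> {x \<circ> transpose i j, x \<circ> transpose k l}" by (rule subsetI)
    then show ?thesis by blast
  next
    case False
    have "\<exists>p q r. p < q \<and> q < r \<and> V \<subseteq> {p, q, r}"
    proof -
      have "i = k \<or> i = l \<or> j = k \<or> j = l"
        using False V[OF p0] lt[OF p0] by (auto simp: card_insert_if split: if_splits)
      then obtain a where a: "V \<subseteq> {i, j, a}" "a \<noteq> i" "a \<noteq> j"
      proof -
        assume *: "\<And>a. V \<subseteq> {i, j, a} \<Longrightarrow> a \<noteq> i \<Longrightarrow> a \<noteq> j \<Longrightarrow> thesis"
        have V0: "V = {i, j, k, l}" by (rule V[OF p0])
        consider "k \<noteq> i" "k \<noteq> j" | "l \<noteq> i" "l \<noteq> j" | "k \<in> {i, j}" "l \<in> {i, j}" by blast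
        then show thesis
        proof cases
          case 1
          then have "l \<in> {i, j}" using \<open>i = k \<or> i = l \<or> j = k \<or> j = l\<close> by blast
          then show thesis using *[of k] 1 V0 by blast
        next
          case 2
          then have "k \<in> {i, j}" using \<open>i = k \<or> i = l \<or> j = k \<or> j = l\<close> by blast
          then show thesis using *[of l] 2 V0 by blast
        next
          case 3
          \<comment> \<open>Here \<open>V\<close> is just \<open>{i, j}\<close>, and
            \<open>Suc j\<close> is a dummy third position.\<close>
          then show thesis using *[of "Suc j"] V0 lt[OF p0] by auto
        qed
      qed
      have "i < j" using lt[OF p0] by simp
      then consider "a < i" | "i < a" "a < j" | "j < a" using a(2,3) by linarith
      then show ?thesis
      proof cases
        case 1
        then show ?thesis using \<open>i < j\<close> a(1) by (intro exI[of _ a] exI[of _ i] exI[of _ j]) auto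
      next
        case 2
        then show ?thesis using a(1) by (intro exI[of _ i] exI[of _ a] exI[of _ j]) auto
      next
        case 3
        then show ?thesis using \<open>i < j\<close> a(1) by (intro exI[of _ i] exI[of _ j] exI[of _ a]) auto
      qed
    qed
    then obtain p q r where pqr: "p < q" "q < r" "V \<subseteq> {p, q, r}" by blast
    have "(a, b) \<in> {(p, q), (p, r), (q, r)} \<and> cover_step m x a b" if pa: "path a b c d" for a b c d
    proof -
      have "a \<in> {p, q, r}" "b \<in> {p, q, r}" "a < b"
        using V[OF pa] lt[OF pa] pqr(3) by auto
      then show ?thesis using pa pqr(1,2) unfolding path_def by auto
    qed
    then have forms: "z = x \<circ> transpose p q \<and> cover_step m x p q \<or>
        z = x \<circ> transpose p r \<and> cover_step m x p r \<or>
        z = x \<circ> transpose q r \<and> cover_step m x q r" if "z \<in> Z" for z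
      using repr[OF that] by (metis Pair_inject empty_iff insert_iff)
    have "\<not> (cover_step m x p q \<and> cover_step m x q r \<and> cover_step m x p r)"
    proof
      assume *: "cover_step m x p q \<and> cover_step m x q r \<and> cover_step m x p r"
      then have "x q < x p" "x r < x q" by (simp_all add: cover_step_def)
      moreover have "x q \<notin> {x r..x p}"
        using * pqr(1,2) unfolding cover_step_def by (meson greaterThanLessThan_iff)
      ultimately show False by simp
    qed
    then consider "\<not> cover_step m x p q" | "\<not> cover_step m x q r" | "\<not> cover_step m x p r" by blast
    then show ?thesis
    proof cases
      case 1
      then have "Z \<subseteq> {x \<circ> transpose p r, x \<circ> transpose q r}" using forms by (intro subsetI) (metis insert_iff)
      then show ?thesis by (intro exI)
    next
      case 2
      then have "Z \<subseteq> {x \<circ> transpose p q, x \<circ> transpose p r}" using forms by (intro subsetI) (metis insert_iff)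
      then show ?thesis by (intro exI)
    next
      case 3
      then have "Z \<subseteq> {x \<circ> transpose p q, x \<circ> transpose q r}" using forms by (intro subsetI) (metis insert_iff)
      then show ?thesis by (intro exI)
    qed
  qed
qed blast

text \<open>The entry at \<open>k\<close> is the element of the common value set with as many values
  below it as there are positions with smaller entries, a number read off the relative
  order.\<close>

lemma W_eqI:
  assumes d: "d \<in> W" "e \<in> W"
    and same: "\<And>i j. i \<in> {1..m} \<Longrightarrow> j \<in> {1..m} \<Longrightarrow> d i < d j \<longleftrightarrow> e i < e j"
  shows "d = e"
proof (rule ext_W[OF d])
  fix k assume k: "k \<in> {1..m}"
  let ?V = "lam ` {1..m}"
  have below: "card {u \<in> ?V. u < f k} = card {l \<in> {1..m}. f l < f k}" if "f \<in> W" for f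
  proof -
    have "{u \<in> ?V. u < f k} = f ` {l \<in> {1..m}. f l < f k}"
      unfolding image_W[OF that, symmetric] by blast
    moreover have "inj_on f {l \<in> {1..m}. f l < f k}"
      using inj_W[OF that] by (rule inj_on_subset) blast
    ultimately show ?thesis by (simp only: card_image)
  qed
  have eq: "card {u \<in> ?V. u < d k} = card {u \<in> ?V. u < e k}"
    unfolding below[OF d(1)] below[OF d(2)] using same[OF _ k] by (metis (mono_tags, lifting))
  have less: "card {u \<in> ?V. u < a} < card {u \<in> ?V. u < b}" if "a \<in> ?V" "a < b" for a b
    using that by (intro psubset_card_mono) auto
  have "d k \<in> ?V" "e k \<in> ?V" using image_W[OF d(1)] image_W[OF d(2)] k by blast+
  then show "d k = e k"
    using less[of "d k" "e k"] less[of "e k" "d k"] eq by (metis less_irrefl nat_neq_iff)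
qed

end

section \<open>Rank, subthinness and the maximum\<close>

context forest
begin

lemma ord_cover_step:
  assumes "x \<in> D" "y \<in> D" "prefix_le x y" "inversions m y = Suc (inversions m x)"
  obtains i j where "cover_step m x i j" "y = x \<circ> transpose i j"
proof -
  have "x \<noteq> y" using assms(4) by auto
  then obtain i j where g: "greedy x y i j" using greedy_exists[OF assms(1-3)] by blast
  note cs = greedy_cover_step[OF assms(1,2) g]
  have "x \<circ> transpose i j = y"
    using inversions_cover_step[OF cs] assms(4) greedy_prefix_le[OF assms(1-3) g]
      inversions_strict_mono[OF cover_step_W[OF D_W[OF assms(1)] cs] D_W[OF assms(2)]]
    by fastforce
  then show thesis using that cs by blast
qed

lemma minimum_lam: "is_minimum D ord lam"
  using lam_D lam_prefix_le D_W by (simp add: is_minimum_def ord_def)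

lemma ord_antisym: "x \<in> D \<Longrightarrow> y \<in> D \<Longrightarrow> prefix_le x y \<Longrightarrow> prefix_le y x \<Longrightarrow> x = y"
  using inversions_strict_mono[of x y] inversions_mono[of y x] D_W by fastforce

text \<open>All maximal chains start at the unique minimum \<open>lam\<close>, and inversions
  prescribe their length. The additive form avoids truncated subtraction.\<close>

lemma rank_ord:
  assumes x: "x \<in> D"
  shows "rank D ord x + inversions m lam = inversions m x"
proof -
  have min: "b = lam" if "is_minimum D ord b" for b
    using that minimum_lam ord_antisym by (auto simp: is_minimum_def ord_def)
  obtain c where c: "maximal_chain D ord lam x c"
    using increasing_chain_exists[OF lam_D x lam_prefix_le[OF D_W[OF x]]] by blast
  have len: "length c' + inversions m lam = Suc (inversions m x)" if "maximal_chain D ord lam x c'" for c'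
    using maximal_chain_length_prefix_le[OF that] by blast
  have "rank D ord x = length c - 1"
    unfolding rank_def
  proof (rule the_equality)
    have "c \<noteq> []" using c by (simp add: maximal_chain_def)
    then show "\<exists>b c'. is_minimum D ord b \<and> maximal_chain D ord b x c' \<and> length c' = Suc (length c - 1)"
      using minimum_lam c by auto
  next
    fix n assume "\<exists>b c'. is_minimum D ord b \<and> maximal_chain D ord b x c' \<and> length c' = Suc n"
    then show "n = length c - 1" using min len[OF c] len by fastforce
  qed
  moreover have "length c \<noteq> 0" using c by (simp add: maximal_chain_def)
  ultimately show ?thesis using len[OF c] by linarith
qed

lemma subthin_ord: "subthin D ord"
  unfolding subthin_def
proof (intro ballI impI, elim conjE)
  fix x y assume x: "x \<in> D" and y: "y \<in> D" and "(x, y) \<in> ord" "rank D ord y = rank D ord x + 2"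
  then have inv: "inversions m y = inversions m x + 2"
    using rank_ord[OF x] rank_ord[OF y] by simp
  have "\<exists>i j k l. cover_step m x i j \<and> z = x \<circ> transpose i j \<and>
      cover_step m z k l \<and> y = z \<circ> transpose k l" if "z \<in> open_interval D ord x y" for z
  proof -
    have z: "z \<in> D" "prefix_le x z" "prefix_le z y" "x \<noteq> z" "z \<noteq> y"
      using that by (auto simp: open_interval_def ord_def)
    have "inversions m z = Suc (inversions m x)" "inversions m y = Suc (inversions m z)"
      using inversions_strict_mono[OF D_W[OF x] D_W[OF z(1)] z(2,4)]
        inversions_strict_mono[OF D_W[OF z(1)] D_W[OF y] z(3,5)] inv by linarith+
    then show ?thesis
      using ord_cover_step[OF x z(1,2)] ord_cover_step[OF z(1) y z(3)] by metis
  qed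
  then obtain z1 z2 where "open_interval D ord x y \<subseteq> {z1, z2}"
    using two_step_interval_le_2[OF D_W[OF x]] by meson
  then show "finite (open_interval D ord x y) \<and> card (open_interval D ord x y) \<le> 2"
    using card_mono[of "{z1, z2}" "open_interval D ord x y"]
    by (auto intro: finite_subset simp: card_insert_if split: if_splits)
qed

text \<open>A disorder of least distance \<open>j - i\<close> is minimal: an offending
  \<open>l\<close> in between would form a closer one with \<open>i\<close> or \<open>j\<close>.
  Laminarity makes \<open>l\<close> incomparable with \<open>j\<close> when it is below
  \<open>i\<close>, and with \<open>i\<close> when it is above \<open>j\<close>.\<close>

lemma exchangeable_exists:
  assumes x: "x \<in> D" and ij: "i \<in> {1..m}" "j \<in> {1..m}" "i < A j" "x j < x i"
  shows "\<exists>i j. exchangeable x i j"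
proof -
  define P where "P = (\<lambda>(i, j). i \<in> {1..m} \<and> j \<in> {1..m} \<and> i < A j \<and> x j < x i)"
  have "P (i, j)" using ij by (simp add: P_def)
  from ex_has_least_nat[of P, OF this, of "\<lambda>(i, j). j - i"] obtain i j where
    p: "P (i, j)" and least: "\<And>i' j'. P (i', j') \<Longrightarrow> j - i \<le> j' - i'"
    by auto
  have ij: "i \<in> {1..m}" "j \<in> {1..m}" "i < A j" "x j < x i"
    using p by (simp_all add: P_def)
  have "(A l \<le> i \<longrightarrow> x l \<le> x j) \<and> (A j \<le> l \<longrightarrow> x i \<le> x l) \<and>
      (i < A l \<and> l < A j \<longrightarrow> x l \<notin> {x j..x i})" if l: "l \<in> {i<..<j}" for l
  proof -
    have lm: "l \<in> {1..m}" using l ij by auto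
    have left: "\<not> (i < A l \<and> x l < x i)" and right: "\<not> (l < A j \<and> x j < x l)"
      using least[of i l] least[of l j] lm ij l by (auto simp: P_def)
    have "A l \<le> i \<Longrightarrow> l < A j"
      using A_laminar[OF ij(2), of l] l ij(3) by fastforce
    moreover have "A j \<le> l \<Longrightarrow> i < A l"
      using A_laminar[OF ij(2), of l] l ij(3) by fastforce
    moreover have "x l \<noteq> x i" using eq_W_iff[OF D_W[OF x] lm ij(1)] l by simp
    ultimately show ?thesis using left right by auto
  qed
  then have "exchangeable x i j" using ij unfolding exchangeable_def by blast
  then show ?thesis by blast
qed

text \<open>
  An element without exchangeable pairs is increasing on incomparable and decreasing on comparable
  positions, so the relative order of all its entries is determined.
\<close>

lemma maximum_exists: "\<exists>x. is_maximum D ord x"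
proof -
  define final where "final x \<longleftrightarrow> x \<in> D \<and> (\<forall>i j. \<not> exchangeable x i j)" for x
  \<comment> \<open>Among the dominant elements above \<open>y\<close>, one with most inversions
    admits no exchange.\<close>
  have above: "\<exists>z. final z \<and> prefix_le y z" if y: "y \<in> D" for y
  proof -
    have "\<exists>z. (z \<in> D \<and> prefix_le y z) \<and> (\<forall>u. u \<in> D \<and> prefix_le y u \<longrightarrow> inversions m u \<le> inversions m z)"
      by (rule ex_has_greatest_nat[where k = y and b = "Suc (m * m)"])
        (use y in \<open>auto simp: less_Suc_eq_le inversions_le\<close>)
    then obtain z where z: "z \<in> D" "prefix_le y z"
      and greatest: "\<And>u. u \<in> D \<Longrightarrow> prefix_le y u \<Longrightarrow> inversions m u \<le> inversions m z" by blast
    have "\<not> exchangeable z i j" for i j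
    proof
      assume "exchangeable z i j"
      then have cs: "cover_step m z i j" and u: "z \<circ> transpose i j \<in> D"
        using exchangeable_iff[OF z(1)] by blast+
      show False
        using greatest[OF u prefix_le_trans[OF z(2) cover_step_prefix_le[OF cs]]]
          inversions_cover_step[OF cs] by simp
    qed
    then show ?thesis using z unfolding final_def by blast
  qed
  have less_iff: "z i < z j \<longleftrightarrow> (if i < j then i < A j else i \<noteq> j \<and> A i \<le> j)"
    if z: "final z" and ij: "i \<in> {1..m}" "j \<in> {1..m}" for z i j
  proof -
    have zD: "z \<in> D" using z by (simp add: final_def)
    have inc: "z a < z b" if "a \<in> {1..m}" "b \<in> {1..m}" "a < A b" for a b
    proof -
      have "\<not> z b < z a"
        using exchangeable_exists[OF zD that] z by (auto simp: final_def)
      moreover have "z a \<noteq> z b"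
        using eq_W_iff[OF D_W[OF zD] that(1,2)] A_bounds[OF that(2)] that(3) by auto
      ultimately show ?thesis by simp
    qed
    have dec: "z b < z a" if "b \<in> {1..m}" "a < b" "A b \<le> a" for a b
      using D_dominant_less[OF zD that(1,3,2)] .
    show ?thesis
      using inc[OF ij] inc[OF ij(2,1)] dec[OF ij(1), of j] dec[OF ij(2), of i]
      by (cases i j rule: linorder_cases; cases "i < A j"; cases "j < A i") auto
  qed
  obtain M where M: "final M" using above[OF lam_D] by blast
  have "prefix_le y M" if "y \<in> D" for y
  proof -
    obtain z where z: "final z" "prefix_le y z" using above[OF \<open>y \<in> D\<close>] by blast
    have "z \<in> W" "M \<in> W" using z(1) M D_W by (auto simp: final_def)
    \<comment> \<open>By \<open>less_iff\<close> all final elements have the same relative order, so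
      the one above \<open>y\<close> is always \<open>M\<close>.\<close>
    then have "z = M"
      by (rule W_eqI) (simp add: less_iff[OF z(1)] less_iff[OF M])
    then show ?thesis using z(2) by simp
  qed
  then have "is_maximum D ord M"
    using M by (auto simp: is_maximum_def ord_def final_def)
  then show ?thesis by blast
qed

lemma bounded_ord: "bounded_poset D ord"
  unfolding bounded_poset_def using minimum_lam maximum_exists by blast

end

subsection \<open>Bubble sort\<close>

context forest
begin

definition dominant_pos :: "nat \<Rightarrow> (nat \<Rightarrow> nat) \<Rightarrow> bool" where
  "dominant_pos k d \<longleftrightarrow> (\<forall>j\<in>{A k..k}. d k \<le> d j)"

text \<open>
  The position j exchanged with k by one bubble-sort step. By the last condition every smaller
  entry between j and k belongs to an element below that of j.
\<close>

definition sift_pos :: "(nat \<Rightarrow> nat) \<Rightarrow> nat \<Rightarrow> nat \<Rightarrow> bool" where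
  "sift_pos d k j \<longleftrightarrow> A k \<le> j \<and> j < k \<and> d j < d k \<and> (\<forall>l\<in>{A j..<j}. d k \<le> d l) \<and>
     (\<forall>t\<in>{j<..<k}. d t < d k \<longrightarrow> A t \<le> j)"

lemma dominant_iff_pos: "dominant d \<longleftrightarrow> (\<forall>k\<in>{1..m}. dominant_pos k d)"
  by (simp add: dominant_def dominant_pos_def)

lemma sift_W:
  assumes "d \<in> W" "k \<in> {1..m}" "sift_pos d k j"
  shows "d \<circ> transpose j k \<in> W"
  using assms A_bounds[OF assms(2)] by (intro transpose_W) (auto simp: sift_pos_def)

text \<open>Read backwards, \<open>d\<close> arises from the sifted composition by an upward
  exchange of \<open>j\<close> and \<open>k\<close>.\<close>

lemma sift_transpose:
  assumes "k \<in> {1..m}" "sift_pos d k j"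
  shows "1 \<le> j" "j < k" "(d \<circ> transpose j k) k < (d \<circ> transpose j k) j"
    "(d \<circ> transpose j k) \<circ> transpose j k = d"
  using assms(2) A_bounds[OF assms(1)] by (auto simp: sift_pos_def comp_assoc)

lemma sift_prefix_le:
  assumes "k \<in> {1..m}" "sift_pos d k j"
  shows "prefix_le (d \<circ> transpose j k) d"
  using prefix_le_transpose[OF sift_transpose(1-3)[OF assms]] unfolding sift_transpose(4)[OF assms] .

text \<open>The entry at \<open>j\<close> grows, which could only harm dominance at \<open>j\<close>
  itself; but entries above \<open>j\<close> are at least \<open>d k\<close> by
  \<open>sift_pos\<close>.\<close>

lemma sift_dominant_pos:
  assumes k: "k \<in> {1..m}" and s: "sift_pos d k j" and l: "l < k" and dom: "dominant_pos l d"
  shows "dominant_pos l (d \<circ> transpose j k)"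
proof -
  let ?e = "d \<circ> transpose j k"
  have jk: "j < k" "d j < d k" and above: "\<And>i. A j \<le> i \<Longrightarrow> i < j \<Longrightarrow> d k \<le> d i"
    using s by (auto simp: sift_pos_def)
  have e: "?e j = d k" "\<And>i. i \<noteq> j \<Longrightarrow> i \<noteq> k \<Longrightarrow> ?e i = d i"
    by (auto simp: transpose_def)
  have "?e l \<le> ?e i" if i: "A l \<le> i" "i \<le> l" for i
  proof -
    have le: "d l \<le> d i" using dom i by (simp add: dominant_pos_def)
    consider "i = l" | "l = j" "i < l" | "l \<noteq> j" "i = j" | "l \<noteq> j" "i \<noteq> j" using i by linarith
    then show ?thesis
    proof cases
      case 2
      then show ?thesis using above[of i] i e l by (simp del: o_apply)
    next
      case 3
      then show ?thesis using le e jk l by (simp del: o_apply)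
    next
      case 4
      then show ?thesis using le e l i by (simp del: o_apply)
    qed (simp only: order_refl)
  qed
  then show ?thesis unfolding dominant_pos_def by (metis atLeastAtMost_iff)
qed

text \<open>Sifting raises counts by one exactly for \<open>j \<le> p < k\<close> and
  \<open>d j < q \<le> d k\<close>, so strictness is needed there. It is shown from
  \<open>p = k - 1\<close> downwards by inspecting the next position \<open>t\<close>.\<close>

lemma sift_greatest:
  assumes k: "k \<in> {1..m}" and s: "sift_pos d k j" and x: "x \<in> D" and le: "prefix_le x d"
  shows "prefix_le x (d \<circ> transpose j k)"
  unfolding prefix_le_def
proof (intro allI)
  fix p q
  let ?e = "d \<circ> transpose j k"
  have Ak: "A k \<le> j" and jk: "j < k" "d j < d k"
    and chain: "\<And>t. j < t \<Longrightarrow> t < k \<Longrightarrow> d t < d k \<Longrightarrow> A t \<le> j"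
    using s by (auto simp: sift_pos_def)
  have le': "prefix_count d p' q' \<le> prefix_count x p' q'" for p' q'
    using le by (simp add: prefix_le_def)
  have strict: "prefix_count d p q < prefix_count x p q"
    if "j \<le> p" "p < k" and q: "d j < q" "q \<le> d k" for p
    using that(1,2)
  proof (induction "k - p" arbitrary: p rule: less_induct)
    case (less p)
    define t where "t = Suc p"
    have t: "j < t" "t \<le> k" "t \<in> {1..m}" using less.prems k by (auto simp: t_def)
    have Suc: "prefix_count f t q = prefix_count f p q + of_bool (q \<le> f t)" for f
      by (simp add: t_def)
    \<comment> \<open>Dominance makes the entries of \<open>x\<close> on \<open>{A t..t}\<close> all
      reach \<open>q\<close>, whereas \<open>d\<close> has a gap at \<open>j\<close>.\<close>
    have fill: ?case if "A t \<le> j" "q \<le> x t"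
    proof -
      have At: "1 \<le> A t" using A_bounds[OF t(3)] by simp
      have full: "q \<le> x l" if "A t - 1 < l" "l \<le> p" for l
      proof -
        have "A t \<le> l" "l \<le> t" using that At by (simp_all add: t_def)
        then show ?thesis using D_dominant[OF x t(3), of l] \<open>q \<le> x t\<close> by simp
      qed
      have "prefix_count d p q < prefix_count d (A t - 1) q + (p - (A t - 1))"
        using that(1) less.prems(1) q(1) At by (intro prefix_count_not_full[of _ j]) auto
      also have "\<dots> \<le> prefix_count x (A t - 1) q + (p - (A t - 1))"
        using le' by simp
      also have "\<dots> = prefix_count x p q"
        using full that(1) less.prems(1) by (intro prefix_count_full[symmetric]) auto
      finally show ?thesis .
    qed
    show ?case
    proof (cases "t = k")
      case True
      show ?thesis
      proof (cases "q \<le> x t")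
        case True
        then show ?thesis using fill Ak \<open>t = k\<close> by simp
      next
        case False
        \<comment> \<open>\<open>d\<close> reaches \<open>q\<close> at \<open>k\<close> and
          \<open>x\<close> does not, so the weak inequality at \<open>k\<close> was strict just
          before.\<close>
        then show ?thesis using Suc[of x] Suc[of d] le'[of t q] \<open>t = k\<close> q(2) by simp
      qed
    next
      case False
      have IH: "prefix_count d t q < prefix_count x t q"
        using less.hyps[of t] less.prems t False by (simp add: t_def)
      consider "q \<le> d t" | "d t < q" "q \<le> x t" | "d t < q" "x t < q" by linarith
      then show ?thesis
      proof cases
        case 1
        then show ?thesis using IH Suc[of x] Suc[of d] by (cases "q \<le> x t") simp_all
      next
        case 2
        then show ?thesis using fill chain[of t] t False q(2) by simp
      next
        case 3
        then show ?thesis using IH Suc[of x] Suc[of d] by simp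
      qed
    qed
  qed
  have "prefix_count d p q + of_bool (j \<le> p \<and> p < k \<and> d j < q \<and> q \<le> d k) = prefix_count ?e p q"
    using prefix_count_transpose[OF sift_transpose(1-3)[OF k s], of p q]
    unfolding sift_transpose(4)[OF k s] by (simp add: comp_def)
  then show "prefix_count ?e p q \<le> prefix_count x p q"
    using strict[of p] le'[of p q] by (cases "j \<le> p \<and> p < k \<and> d j < q \<and> q \<le> d k") auto
qed

end

section \<open>Transfer between the poset \<open>S\<close> and positions\<close>

locale labelled_forest = forest +
  fixes S :: "'s set" and r :: "'s rel" and v :: "'s \<Rightarrow> nat"
  assumes bij: "bij_betw v S {1..m}"
    and rel_iff: "s \<in> S \<Longrightarrow> t \<in> S \<Longrightarrow> (s, t) \<in> r \<longleftrightarrow> v t \<in> {A (v s)..v s}"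
begin

lemma v_in: "s \<in> S \<Longrightarrow> v s \<in> {1..m}"
  using bij by (auto simp: bij_betw_def)

lemma v_inj: "s \<in> S \<Longrightarrow> t \<in> S \<Longrightarrow> v s = v t \<longleftrightarrow> s = t"
  using bij by (auto simp: bij_betw_def inj_on_def)

lemma v_obtain:
  assumes "k \<in> {1..m}"
  obtains s where "s \<in> S" "v s = k"
proof -
  have "k \<in> v ` S" using assms bij by (simp add: bij_betw_def)
  then show thesis using that by (metis imageE)
qed

lemma strict_rel_iff: "s \<in> S \<Longrightarrow> t \<in> S \<Longrightarrow> (s, t) \<in> r - Id \<longleftrightarrow> A (v s) \<le> v t \<and> v t < v s"
  using rel_iff[of s t] v_inj[of s t] by auto

lemma dominant_at_iff:
  assumes k: "k \<in> {1..m}"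
  shows "dominant_at S r v k d \<longleftrightarrow> dominant_pos k d"
proof
  assume L: "dominant_at S r v k d"
  obtain t where t: "t \<in> S" "v t = k" using v_obtain[OF k] .
  have "d k \<le> d j" if j: "j \<in> {A k..k}" for j
  proof (cases "j = k")
    case False
    have "j \<in> {1..m}" using j k A_bounds[OF k] by auto
    then obtain s where s: "s \<in> S" "v s = j" by (rule v_obtain)
    then have "(t, s) \<in> r - Id" using strict_rel_iff[OF t(1) s(1)] t s j False by simp
    then show ?thesis using L s t unfolding dominant_at_def by metis
  qed simp
  then show "dominant_pos k d" by (simp add: dominant_pos_def)
next
  assume R: "dominant_pos k d"
  then show "dominant_at S r v k d"
    using strict_rel_iff unfolding dominant_at_def dominant_pos_def
    by (metis atLeastAtMost_iff less_imp_le)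
qed

lemma S_dominant_iff: "S_dominant m S r v d \<longleftrightarrow> dominant d"
proof -
  have "v ` S = {1..m}" using bij by (simp add: bij_betw_def)
  then have "S_dominant m S r v d \<longleftrightarrow> (\<forall>k\<in>{1..m}. dominant_at S r v k d)"
    unfolding S_dominant_def dominant_at_def using v_in by blast
  then show ?thesis by (simp add: dominant_iff_pos dominant_at_iff)
qed

lemma dominant_set_eq: "dominant_set m S r v lam = D"
  by (simp add: dominant_set_def D_def S_dominant_iff)

lemma dominant_order_eq: "dominant_order m S r v lam = ord"
  unfolding dominant_order_def dominant_set_eq ord_def using bruhat_iff D_W by auto

lemma incomparable_iff:
  assumes "s \<in> S" "t \<in> S" "v s < v t"
  shows "incomparable r s t \<longleftrightarrow> v s < A (v t)"
  using assms rel_iff[of s t] rel_iff[of t s] by (auto simp: incomparable_def)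

lemma incomparable_commute: "incomparable r s t \<longleftrightarrow> incomparable r t s"
  by (auto simp: incomparable_def)

lemma minimal_disorder_iff:
  "minimal_disorder m S r v d i j \<longleftrightarrow> dominant d \<and> exchangeable d i j"
proof
  assume md: "minimal_disorder m S r v d i j"
  then obtain s t where st: "s \<in> S" "t \<in> S" "v s = i" "v t = j" "i < j" "d j < d i"
    and inc: "incomparable r s t" and dom: "dominant d"
    and min: "\<And>u. u \<in> S \<Longrightarrow> i < v u \<Longrightarrow> v u < j \<Longrightarrow>
           ((u, s) \<in> r - Id \<longrightarrow> d (v u) \<le> d j) \<and>
           ((t, u) \<in> r - Id \<longrightarrow> d (v u) \<ge> d i) \<and>
           (incomparable r u s \<and> incomparable r u t \<longrightarrow> d (v u) \<notin> {d j..d i})"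
    unfolding minimal_disorder_def S_dominant_iff by auto
  have ij: "i \<in> {1..m}" "j \<in> {1..m}" using v_in st by blast+
  have "i < A j" using incomparable_iff[OF st(1,2)] st inc by simp
  moreover have "(A l \<le> i \<longrightarrow> d l \<le> d j) \<and> (A j \<le> l \<longrightarrow> d i \<le> d l) \<and>
        (i < A l \<and> l < A j \<longrightarrow> d l \<notin> {d j..d i})" if l: "l \<in> {i<..<j}" for l
  proof -
    have "l \<in> {1..m}" using l ij by auto
    then obtain u where u: "u \<in> S" "v u = l" by (rule v_obtain)
    then show ?thesis
      using min[OF u(1)] l st strict_rel_iff[OF u(1) st(1)] strict_rel_iff[OF st(2) u(1)]
        incomparable_iff[OF st(1) u(1)] incomparable_iff[OF u(1) st(2)]
        incomparable_commute[of s u] by simp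
  qed
  ultimately show "dominant d \<and> exchangeable d i j"
    using dom ij st(6) unfolding exchangeable_def by blast
next
  assume "dominant d \<and> exchangeable d i j"
  then have dom: "dominant d" and ij: "i \<in> {1..m}" "j \<in> {1..m}" "i < A j" "d j < d i"
    and btw: "\<forall>l\<in>{i<..<j}. (A l \<le> i \<longrightarrow> d l \<le> d j) \<and> (A j \<le> l \<longrightarrow> d i \<le> d l) \<and>
        (i < A l \<and> l < A j \<longrightarrow> d l \<notin> {d j..d i})"
    unfolding exchangeable_def by blast+
  obtain s where s: "s \<in> S" "v s = i" using v_obtain[OF ij(1)] .
  obtain t where t: "t \<in> S" "v t = j" using v_obtain[OF ij(2)] .
  have lt: "i < j" using ij(3) A_bounds[OF ij(2)] by linarith
  have inc: "incomparable r s t" using incomparable_iff[OF s(1) t(1)] s t ij(3) lt by simp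
  have "((u, s) \<in> r - Id \<longrightarrow> d (v u) \<le> d j) \<and> ((t, u) \<in> r - Id \<longrightarrow> d (v u) \<ge> d i) \<and>
      (incomparable r u s \<and> incomparable r u t \<longrightarrow> d (v u) \<notin> {d j..d i})"
    if u: "u \<in> S" "i < v u \<and> v u < j" for u
    using bspec[OF btw, of "v u"] u s t strict_rel_iff[OF u(1) s(1)] strict_rel_iff[OF t(1) u(1)]
      incomparable_iff[OF s(1) u(1)] incomparable_iff[OF u(1) t(1)]
      incomparable_commute[of s u] by simp
  then show "minimal_disorder m S r v d i j"
    unfolding minimal_disorder_def S_dominant_iff using dom s t lt inc ij(4) by blast
qed

text \<open>\<open>J\<close> consists of the positions of the maximal elements in the bubble-sort
  step. Its maximum is a sift position because each smaller entry left of \<open>k\<close> has a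
  member of \<open>J\<close> weakly above it.\<close>

lemma bs_step_sift:
  assumes k: "k \<in> {1..m}" and nd: "\<not> dominant_pos k d"
  obtains j where "sift_pos d k j" "bs_step S r v k d = d \<circ> transpose j k"
proof -
  define X where "X = {s \<in> S. v s < k \<and> d (v s) < d k}"
  define J where "J = {j \<in> {1..m}. j < k \<and> d j < d k \<and> (\<forall>l\<in>{A j..<j}. d k \<le> d l)}"
  have "v ` maximal_elements r X = J"
  proof (intro set_eqI iffI)
    fix j assume "j \<in> v ` maximal_elements r X"
    then obtain s where s: "s \<in> S" "v s = j" "j < k" "d j < d k"
      and max: "\<And>u. u \<in> S \<Longrightarrow> v u < k \<Longrightarrow> d (v u) < d k \<Longrightarrow> (s, u) \<notin> r - Id"
      by (auto simp: maximal_elements_def X_def)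
    have j: "j \<in> {1..m}" using s v_in by blast
    have "d k \<le> d l" if l: "l \<in> {A j..<j}" for l
    proof -
      have "l \<in> {1..m}" using l j A_bounds[OF j] by auto
      then obtain u where u: "u \<in> S" "v u = l" by (rule v_obtain)
      have "(s, u) \<in> r - Id" using strict_rel_iff[OF s(1) u(1)] s u l by simp
      then show ?thesis using max[OF u(1)] u l s(3) by fastforce
    qed
    then show "j \<in> J" using j s by (simp add: J_def)
  next
    fix j assume j: "j \<in> J"
    then obtain s where s: "s \<in> S" "v s = j" unfolding J_def using v_obtain by blast
    have "(s, u) \<notin> r - Id" if u: "u \<in> X" for u
    proof
      assume "(s, u) \<in> r - Id"
      then have "v u \<in> {A j..<j}" using strict_rel_iff[OF s(1), of u] u s by (simp add: X_def)
      then have "d k \<le> d (v u)" using j unfolding J_def by blast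
      then show False using u by (simp add: X_def)
    qed
    then show "j \<in> v ` maximal_elements r X"
      using s j by (auto simp: maximal_elements_def X_def J_def)
  qed
  then have step: "bs_step S r v k d = d \<circ> transpose (Max J) k"
    by (simp add: bs_step_def X_def Let_def)
  have fin: "finite J" by (simp add: J_def)
  have JD: "j < k \<and> d j < d k \<and> (\<forall>l\<in>{A j..<j}. d k \<le> d l)" if "j \<in> J" for j
    using that by (simp add: J_def)
  have J_below: "\<exists>l\<in>J. A t \<le> l \<and> l \<le> t" if t: "t \<in> {1..m}" "t < k" "d t < d k" for t
  proof -
    \<comment> \<open>The leftmost smaller entry in the block of \<open>t\<close> is maximal, since
      by laminarity its own block stays inside that of \<open>t\<close>.\<close>
    let ?P = "\<lambda>l. A t \<le> l \<and> l \<le> t \<and> d l < d k"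
    define l where "l = Least ?P"
    have "?P t" using t A_bounds[OF t(1)] by simp
    then have l: "?P l" unfolding l_def by (rule LeastI)
    have lm: "l \<in> {1..m}" using l t A_bounds[OF t(1)] by auto
    have "d k \<le> d i" if i: "i \<in> {A l..<l}" for i
    proof -
      have "\<not> ?P i" using not_less_Least[of i ?P] i unfolding l_def[symmetric] by simp
      moreover have "A t \<le> i" "i \<le> t" using A_laminar[OF t(1), of l] l i by auto
      ultimately show ?thesis by simp
    qed
    then show ?thesis using l lm t(2) by (auto simp: J_def)
  qed
  obtain j0 where j0: "A k \<le> j0" "j0 \<le> k" "d j0 < d k"
    using nd by (auto simp: dominant_pos_def not_le)
  then have "j0 < k" "j0 \<in> {1..m}" using k A_bounds[OF k] by (auto simp: le_less)
  with J_below[of j0] j0 obtain l0 where l0: "l0 \<in> J" "A j0 \<le> l0" by blast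
  have MJ: "Max J \<in> J" using fin l0 by (intro Max_in) auto
  \<comment> \<open>Failure of dominance at \<open>k\<close> supplied \<open>j0\<close>, whence
    \<open>A k \<le> A j0 \<le> l0 \<le> Max J\<close>.\<close>
  have "A k \<le> A j0" using A_laminar[OF k] j0 by simp
  then have "A k \<le> Max J" using Max_ge[OF fin l0(1)] l0(2) by linarith
  moreover have "A t \<le> Max J" if t: "t \<in> {Max J<..<k}" "d t < d k" for t
  proof -
    have "t \<in> {1..m}" using t k by auto
    then obtain l where "l \<in> J" "A t \<le> l" using J_below[of t] t by auto
    then show ?thesis using Max_ge[OF fin] by fastforce
  qed
  moreover have "Max J < k" "d (Max J) < d k" "\<forall>l\<in>{A (Max J)..<Max J}. d k \<le> d l"
    using JD[OF MJ] by blast+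
  ultimately have "sift_pos d k (Max J)"
    unfolding sift_pos_def by blast
  then show thesis using step by (rule that)
qed

text \<open>Dominance of \<open>e\<close> is left out, so that the property holds for
  \<open>e = d\<close> at the start and survives each exchange as an invariant.\<close>

definition greatest_below :: "(nat \<Rightarrow> nat) \<Rightarrow> (nat \<Rightarrow> nat) \<Rightarrow> bool" where
  "greatest_below d e \<longleftrightarrow> prefix_le e d \<and> (\<forall>x\<in>D. prefix_le x d \<longrightarrow> prefix_le x e)"

lemma bs_at_invariant:
  assumes k: "k \<in> {1..m}" and d: "d \<in> W" and dom: "\<And>l. l \<in> {1..<k} \<Longrightarrow> dominant_pos l d"
    and gb: "greatest_below d0 d"
  shows "bs_at S r v k d \<in> W \<and> (\<forall>l\<in>{1..k}. dominant_pos l (bs_at S r v k d)) \<and>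
    greatest_below d0 (bs_at S r v k d)"
  unfolding bs_at_def
\<comment> \<open>Each exchange lowers the entry at \<open>k\<close>, which gives
  termination.\<close>
proof (rule while_rule[where P = "\<lambda>d. d \<in> W \<and> (\<forall>l\<in>{1..<k}. dominant_pos l d) \<and> greatest_below d0 d"
      and r = "measure (\<lambda>d. d k)"])
  show "d \<in> W \<and> (\<forall>l\<in>{1..<k}. dominant_pos l d) \<and> greatest_below d0 d"
    using assms by blast
next
  fix e
  assume P: "e \<in> W \<and> (\<forall>l\<in>{1..<k}. dominant_pos l e) \<and> greatest_below d0 e"
    and b: "\<not> dominant_at S r v k e"
  obtain j where j: "sift_pos e k j" "bs_step S r v k e = e \<circ> transpose j k"
    using bs_step_sift[OF k] b dominant_at_iff[OF k] by metis
  have "e \<circ> transpose j k \<in> W" using sift_W[OF _ k j(1)] P by blast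
  moreover have "\<forall>l\<in>{1..<k}. dominant_pos l (e \<circ> transpose j k)"
    using sift_dominant_pos[OF k j(1)] P by simp
  moreover have "greatest_below d0 (e \<circ> transpose j k)"
    using sift_prefix_le[OF k j(1)] sift_greatest[OF k j(1)] P prefix_le_trans
    unfolding greatest_below_def by blast
  ultimately show "bs_step S r v k e \<in> W \<and> (\<forall>l\<in>{1..<k}. dominant_pos l (bs_step S r v k e)) \<and>
      greatest_below d0 (bs_step S r v k e)"
    using j(2) by simp
  show "(bs_step S r v k e, e) \<in> measure (\<lambda>d. d k)"
    using j by (simp add: sift_pos_def)
next
  fix e
  assume P: "e \<in> W \<and> (\<forall>l\<in>{1..<k}. dominant_pos l e) \<and> greatest_below d0 e"
    and b: "\<not> \<not> dominant_at S r v k e"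
  then have "dominant_pos l e" if "l \<in> {1..k}" for l
    using that dominant_at_iff[OF k] by (cases "l = k") auto
  then show "e \<in> W \<and> (\<forall>l\<in>{1..k}. dominant_pos l e) \<and> greatest_below d0 e"
    using P by blast
qed simp

lemma bs_greatest_below:
  assumes d: "d \<in> W"
  shows "bs m S r v d \<in> D" "greatest_below d (bs m S r v d)"
proof -
  have "fold (bs_at S r v) [1..<Suc n] d \<in> W \<and>
      (\<forall>l\<in>{1..n}. dominant_pos l (fold (bs_at S r v) [1..<Suc n] d)) \<and>
      greatest_below d (fold (bs_at S r v) [1..<Suc n] d)" if "n \<le> m" for n
    using that
  proof (induction n)
    case 0
    then show ?case using d by (simp add: greatest_below_def)
  next
    case (Suc n)
    let ?e = "fold (bs_at S r v) [1..<Suc n] d"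
    have "fold (bs_at S r v) [1..<Suc (Suc n)] d = bs_at S r v (Suc n) ?e"
      by simp
    moreover have "{1..<Suc n} = {1..n}" by auto
    ultimately show ?case
      using bs_at_invariant[of "Suc n" ?e d] Suc by simp
  qed
  from this[of m] show "bs m S r v d \<in> D" "greatest_below d (bs m S r v d)"
    by (auto simp: bs_def D_def dominant_iff_pos)
qed

lemma bs_fixes_D:
  assumes "d \<in> D"
  shows "bs m S r v d = d"
  using bs_greatest_below[OF D_W[OF assms]] assms ord_antisym
  by (auto simp: greatest_below_def)

end

theorem theorem2p33:
  fixes m :: nat and S :: "'s set" and r :: "'s rel" and v :: "'s \<Rightarrow> nat"
    and lam :: "nat \<Rightarrow> nat"
  assumes "arborescent_poset m S r v"
    and "bij_betw v S {1..m}"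
    and "strict_antimono_on {1..m} lam"
    and "\<forall>l. l \<notin> {1..m} \<longrightarrow> lam l = 0"
  shows
    "let D = dominant_set m S r v lam; ord = dominant_order m S r v lam in
     (\<forall>a\<in>D. \<forall>b. covers D ord a b \<longleftrightarrow>
        (\<exists>i j. minimal_disorder m S r v a i j \<and> b = a \<circ> transpose i j)) \<and>
     (bounded_poset D ord \<and> graded_poset D ord \<and> subthin D ord \<and> EL_shellable D ord) \<and>
     (bs m S r v ` rearrangements m lam = D \<and>
      monotone_on (rearrangements m lam) (\<lambda>a b. (a, b) \<in> bruhat m lam)
        (\<lambda>a b. (a, b) \<in> bruhat m lam) (bs m S r v) \<and>
      (\<forall>d\<in>rearrangements m lam. (bs m S r v d, d) \<in> bruhat m lam) \<and>
      (\<forall>d\<in>rearrangements m lam. bs m S r v (bs m S r v d) = bs m S r v d))"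
proof -
  have po: "partial_order_on S r" and anti: "\<And>s t. s \<in> S \<Longrightarrow> t \<in> S \<Longrightarrow> (t, s) \<in> r - Id \<Longrightarrow> v s < v t"
    and ivl: "\<And>s. s \<in> S \<Longrightarrow> \<exists>a b. a \<le> b \<and> {t \<in> S. (s, t) \<in> r} = {t \<in> S. v t \<in> {a..b}}"
    using assms(1) by (auto simp: arborescent_poset_def)
  have refl: "(s, s) \<in> r" if "s \<in> S" for s
    using po that by (auto simp: partial_order_on_def preorder_on_def refl_on_def)
  have tr: "trans r" using po by (simp add: partial_order_on_def preorder_on_def)
  have v_in: "v s \<in> {1..m}" if "s \<in> S" for s
    using assms(2) that by (auto simp: bij_betw_def)
  define inv_v where "inv_v = inv_into S v"
  have inv_v: "inv_v k \<in> S" "v (inv_v k) = k" if "k \<in> {1..m}" for k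
    using bij_betw_inv_into_right[OF assms(2) that] bij_betw_inv_into[OF assms(2)] that
    by (auto simp: inv_v_def bij_betw_def)
  have inv_v_v: "inv_v (v s) = s" if "s \<in> S" for s
    using bij_betw_inv_into_left[OF assms(2) that] by (simp add: inv_v_def)
  \<comment> \<open>The bounds given for an upper set may overshoot \<open>{1..m}\<close>; the least
    position attained is its sharp left end.\<close>
  define A where "A k = (LEAST l. l \<in> v ` {t \<in> S. (inv_v k, t) \<in> r})" for k
  have rel: "(s, t) \<in> r \<longleftrightarrow> v t \<in> {A (v s)..v s}" if s: "s \<in> S" and t: "t \<in> S" for s t
  proof -
    obtain a b where ab: "{t \<in> S. (s, t) \<in> r} = {t \<in> S. v t \<in> {a..b}}" using ivl[OF s] by blast
    let ?U = "v ` {t \<in> S. (s, t) \<in> r}"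
    have A: "A (v s) = (LEAST l. l \<in> ?U)" by (simp add: A_def inv_v_v[OF s])
    have sU: "v s \<in> ?U" using s refl by blast
    have "A (v s) \<in> ?U" unfolding A using sU by (rule LeastI[where P = "\<lambda>l. l \<in> ?U"])
    then obtain u where u: "u \<in> S" "(s, u) \<in> r" "v u = A (v s)" by auto
    have "u \<in> {t \<in> S. v t \<in> {a..b}}" "s \<in> {t \<in> S. v t \<in> {a..b}}"
      using u s refl unfolding ab[symmetric] by blast+
    then have bounds: "a \<le> A (v s)" "v s \<le> b" using u by auto
    show ?thesis
    proof
      assume st: "(s, t) \<in> r"
      then have "A (v s) \<le> v t" unfolding A using t by (intro Least_le) blast
      moreover have "v t \<le> v s" using anti[OF t s] st by (cases "s = t") auto
      ultimately show "v t \<in> {A (v s)..v s}" by simp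
    next
      assume "v t \<in> {A (v s)..v s}"
      then have "t \<in> {t \<in> S. v t \<in> {a..b}}" using bounds t by auto
      then show "(s, t) \<in> r" unfolding ab[symmetric] by blast
    qed
  qed
  interpret labelled_forest m lam A S r v
  proof
    fix k assume k: "k \<in> {1..m}"
    note K = inv_v[OF k]
    have Ak: "A k \<in> v ` {t \<in> S. (inv_v k, t) \<in> r}"
      unfolding A_def by (rule LeastI[where P = "\<lambda>l. l \<in> v ` {t \<in> S. (inv_v k, t) \<in> r}" and k = k]) (use K refl in force)
    then show "1 \<le> A k \<and> A k \<le> k"
      using v_in rel[OF K(1)] K by fastforce
    fix j assume j: "j \<in> {A k..k}"
    have "j \<in> {1..m}" using j k \<open>1 \<le> A k \<and> A k \<le> k\<close> by auto
    note J = inv_v[OF this]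
    \<comment> \<open>Laminarity is transitivity: whatever is above \<open>inv_v j\<close> is above
      \<open>inv_v k\<close>.\<close>
    have kj: "(inv_v k, inv_v j) \<in> r" using rel[OF K(1) J(1)] K J j by simp
    have "A j \<in> v ` {t \<in> S. (inv_v j, t) \<in> r}"
      unfolding A_def by (rule LeastI[where P = "\<lambda>l. l \<in> v ` {t \<in> S. (inv_v j, t) \<in> r}" and k = j]) (use J refl in force)
    then obtain u where "u \<in> S" "(inv_v j, u) \<in> r" "v u = A j" by auto
    then show "A k \<le> A j"
      using rel[OF K(1), of u] K transD[OF tr kj, of u] by simp
  qed (use assms rel in auto)
  have bs_le: "(bs m S r v d, e) \<in> bruhat m lam \<longleftrightarrow> prefix_le (bs m S r v d) e"
    if "d \<in> W" "e \<in> W" for d e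
    using bruhat_iff[OF D_W[OF bs_greatest_below(1)[OF that(1)]] that(2)] .
  have cov: "covers D ord a b \<longleftrightarrow> (\<exists>i j. minimal_disorder m S r v a i j \<and> b = a \<circ> transpose i j)"
    if a: "a \<in> D" for a b
    unfolding covers_ord_iff minimal_disorder_iff exchangeable_iff[OF a]
    using a by (auto simp: D_def)
  have img: "bs m S r v ` W = D"
    using bs_greatest_below(1) bs_fixes_D D_W by (metis (no_types, lifting) image_eqI image_subset_iff subsetI subset_antisym)
  have mono: "(bs m S r v d, bs m S r v e) \<in> bruhat m lam"
    if "d \<in> W" "e \<in> W" "(d, e) \<in> bruhat m lam" for d e
  proof -
    \<comment> \<open>The sorted \<open>d\<close> is a dominant element below \<open>e\<close>,
      hence below the greatest such element, the sorted \<open>e\<close>.\<close>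
    have "prefix_le (bs m S r v d) e"
      using bs_greatest_below(2)[OF that(1)] that(3) bruhat_iff[OF that(1,2)] prefix_le_trans
      unfolding greatest_below_def by blast
    then have "prefix_le (bs m S r v d) (bs m S r v e)"
      using bs_greatest_below(2)[OF that(2)] bs_greatest_below(1)[OF that(1)]
      unfolding greatest_below_def by blast
    then show ?thesis
      using bs_le[OF that(1)] D_W[OF bs_greatest_below(1)[OF that(2)]] by blast
  qed
  have "(bs m S r v d, d) \<in> bruhat m lam" if "d \<in> W" for d
    using bs_le[OF that that] bs_greatest_below(2)[OF that] by (simp add: greatest_below_def)
  moreover have "bs m S r v (bs m S r v d) = bs m S r v d" if "d \<in> W" for d
    using bs_fixes_D bs_greatest_below(1)[OF that] by blast
  ultimately show ?thesis
    unfolding Let_def dominant_set_eq dominant_order_eq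
    using cov bounded_ord graded_ord subthin_ord EL_shellable_ord img mono
    by (simp add: monotone_on_def)
qed

end
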